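(* Let $\Gamma=(G,\sigma)$ be a signed graph on $N$ vertices and $k\in\{1,2,\dots,N\}$. Then $$h_1^{\sigma}(\mu_d)<16\sqrt{2}\,k\,\frac{\lambda_1(\Delta^{\sigma})}{\sqrt{\lambda_k(\Delta^{\sigma})}}.$$
   Context: A signed graph $\Gamma=(G,\sigma)$ consists of a finite simple undirected graph $G=(V,E)$ with $N=|V|$ vertices, positive symmetric edge weights $w_{uv}>0$ for $\{u,v\}\in E$ ($w_{uv}=0$ otherwise), and a signature $\sigma:E\to\{+1,-1\}$; write $\sigma(uv)=\sigma(\{u,v\})$. The degree is $d_u=\sum_v w_{uv}$ (assumed positive). $D=\mathrm{diag}(d_u)$, $A^{\sigma}_{uv}=\sigma(uv)w_{uv}$ for edges and $0$ otherwise, $\Delta^{\sigma}=I-D^{-1}A^{\sigma}$, with eigenvalues $0\le\lambda_1(\Delta^\sigma)\le\cdots\le\lambda_N(\Delta^\sigma)\le2$. For a positive measure $\mu$ on $V$, $\mathrm{vol}_\mu(S)=\sum_{u\in S}\mu(u)$; $\mu_d(u)=d_u$. For $V_1,V_2\subseteq V$, $|E(V_1,V_2)|=\sum_{u\in V_1}\sum_{v\in V_2}w_{uv}$, $|E^{\pm}(V_1,V_2)|=\sum_{u\in V_1}\sum_{v\in V_2,\sigma(uv)=\pm1}w_{uv}$, $|E^\pm(V_1)|=|E^\pm(V_1,V_1)|$. For disjoint $V_1,V_2\subseteq V$ with $V_1\cup V_2\ne\emptyset$, $$\beta^{\sigma}(V_1,V_2)=\frac{2|E^{+}(V_1,V_2)|+|E^-(V_1)|+|E^-(V_2)|+|E(V_1\cup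 V_2,\overline{V_1\cup V_2})|}{\mathrm{vol}_{\mu}(V_1\cup V_2)},$$ and $h_1^\sigma(\mu)$ is the minimum of $\beta^\sigma(V_1,V_2)$ over all such pairs.
   Formalization: The strict inequality is asserted only when λ₁(Δ^σ) ≠ 0, and ≤ holds in general (0/0 read as 0), because strictness fails for λ₁ = 0: a single positive edge with N = k = 2 has λ = (0, 2) and h₁ = 0, giving 0 < 0. *)

theory Defs
  imports "HOL-Analysis.Analysis" "HOL-Computational_Algebra.Computational_Algebra"
begin

(* The vertex set is the whole (finite) type 'v, so N = CARD('v).  Weights are a
   total function on pairs of vertices; the values of sgn_of off the edge set are
   irrelevant, as every use below is guarded by membership in the edge set. *)

record 'v signed_graph =
  edges :: "'v set set"
  weight :: "'v \<Rightarrow> 'v \<Rightarrow> real"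
  sgn_of :: "'v set \<Rightarrow> int"

definition vdegree :: "'v::finite signed_graph \<Rightarrow> 'v \<Rightarrow> real" where
  "vdegree \<Gamma> u = (\<Sum>v\<in>UNIV. weight \<Gamma> u v)"

definition is_signed_graph :: "'v::finite signed_graph \<Rightarrow> bool" where
  "is_signed_graph \<Gamma> \<longleftrightarrow>
     (\<forall>e\<in>edges \<Gamma>. card e = 2) \<and>
     (\<forall>u v. {u, v} \<in> edges \<Gamma> \<longrightarrow> weight \<Gamma> u v > 0) \<and>
     (\<forall>u v. {u, v} \<notin> edges \<Gamma> \<longrightarrow> weight \<Gamma> u v = 0) \<and>
     (\<forall>u v. weight \<Gamma> u v = weight \<Gamma> v u) \<and>
     (\<forall>e\<in>edges \<Gamma>. sgn_of \<Gamma> e = 1 \<or> sgn_of \<Gamma> e = -1) \<and>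
     (\<forall>u. vdegree \<Gamma> u > 0)"

definition degree_matrix :: "'v::finite signed_graph \<Rightarrow> real ^ 'v ^ 'v" where
  "degree_matrix \<Gamma> = (\<chi> u v. if u = v then vdegree \<Gamma> u else 0)"

definition signed_adjacency :: "'v::finite signed_graph \<Rightarrow> real ^ 'v ^ 'v" where
  "signed_adjacency \<Gamma> = (\<chi> u v.
     if {u, v} \<in> edges \<Gamma> then of_int (sgn_of \<Gamma> {u, v}) * weight \<Gamma> u v else 0)"

definition signed_laplacian :: "'v::finite signed_graph \<Rightarrow> real ^ 'v ^ 'v" where
  "signed_laplacian \<Gamma> = mat 1 - matrix_inv (degree_matrix \<Gamma>) ** signed_adjacency \<Gamma>"

definition charpoly :: "real ^ 'n ^ 'n \<Rightarrow> real poly" where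
  "charpoly M = det (mat [:0, 1:] - (\<chi> i j. [:M $ i $ j:]))"

(* The k-th smallest real eigenvalue (k = 1, 2, ...), counted with algebraic
   multiplicity.  If M has fewer than k real eigenvalues the value is unspecified;
   this does not happen for the signed Laplacian with k at most N, as that matrix is
   similar to a symmetric one. *)

definition eigval :: "nat \<Rightarrow> real ^ 'n ^ 'n \<Rightarrow> real" where
  "eigval k M = sorted_list_of_multiset (proots (charpoly M)) ! (k - 1)"

definition vol :: "('v \<Rightarrow> real) \<Rightarrow> 'v set \<Rightarrow> real" where
  "vol \<mu> S = (\<Sum>u\<in>S. \<mu> u)"

(* Sums over ordered pairs: an edge inside the intersection of V1 and V2 is counted
   twice, in particular every edge is counted twice when V1 = V2. *)

definition cut :: "'v signed_graph \<Rightarrow> 'v set \<Rightarrow> 'v set \<Rightarrow> real" where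
  "cut \<Gamma> V1 V2 = (\<Sum>u\<in>V1. \<Sum>v\<in>V2. weight \<Gamma> u v)"

definition signed_cut :: "int \<Rightarrow> 'v signed_graph \<Rightarrow> 'v set \<Rightarrow> 'v set \<Rightarrow> real" where
  "signed_cut s \<Gamma> V1 V2 =
     (\<Sum>u\<in>V1. \<Sum>v | v \<in> V2 \<and> {u, v} \<in> edges \<Gamma> \<and> sgn_of \<Gamma> {u, v} = s. weight \<Gamma> u v)"

definition signed_beta ::
  "'v signed_graph \<Rightarrow> ('v \<Rightarrow> real) \<Rightarrow> 'v set \<Rightarrow> 'v set \<Rightarrow> real" where
  "signed_beta \<Gamma> \<mu> V1 V2 =
     (2 * signed_cut 1 \<Gamma> V1 V2 + signed_cut (-1) \<Gamma> V1 V1 + signed_cut (-1) \<Gamma> V2 V2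
        + cut \<Gamma> (V1 \<union> V2) (- (V1 \<union> V2)))
     / vol \<mu> (V1 \<union> V2)"

definition cheeger1 :: "'v::finite signed_graph \<Rightarrow> ('v \<Rightarrow> real) \<Rightarrow> real" where
  "cheeger1 \<Gamma> \<mu> =
     Min {signed_beta \<Gamma> \<mu> V1 V2 | V1 V2. V1 \<inter> V2 = {} \<and> V1 \<union> V2 \<noteq> {}}"

end

theory Submission
  imports Defs
begin

text \<open>
  Let \<open>f\<close> be an eigenfunction for \<open>\<lambda>\<^sub>1\<close>.  By the coarea inequality, \<open>h\<^sub>1 \<Sum>d\<bar>g\<bar>\<close> is at most the total
  variation of \<open>g\<close> for every real function \<open>g\<close>.  Following Kwok, Lau, Lee, Oveis Gharan and Trevisan,
  \<open>2k + 1\<close> thresholds \<open>0 = t\<^sub>0 \<le> \<dots> \<le> t\<^bsub>2k\<^esub>\<close> are placed greedily so that the part of \<open>f\<close> lying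
  between consecutive thresholds is within a fixed squared distance \<open>C\<close>, of order
  \<open>\<lambda>\<^sub>1 / (k \<lambda>\<^sub>k)\<close>, of these thresholds.  If they did not reach \<open>max \<bar>f\<bar>\<close>, the pieces of \<open>f\<close> would be
  \<open>2k\<close> disjointly supported functions of mass \<open>C\<close> and total energy at most \<open>2 \<lambda>\<^sub>1\<close>; the \<open>k\<close> of them with
  least energy would contradict the min-max principle for \<open>\<lambda>\<^sub>k\<close>.  So \<open>f\<close> is close to a function with
  few values, and the coarea inequality, applied to the composition of \<open>f\<close> with the antiderivative
  of the distance to the thresholds, gives the bound.
\<close>

section \<open>Spectral theory of real symmetric matrices\<close>

text \<open>Supplies the first-order condition at an extremum: were \<open>b\<close> nonzero, the
  linear term would dominate for small \<open>t\<close> of the sign opposite to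
  \<open>b\<close>.\<close>

lemma nonneg_quadratic_imp_linear_coeff_zero:
  fixes b c :: real
  assumes "\<And>t. 0 \<le> 2 * t * b + t\<^sup>2 * c"
  shows "b = 0"
proof -
  have c: "0 \<le> c" using assms[of 1] assms[of "-1"] by simp
  have "2 * (- b / (c + 1)) * b + (- b / (c + 1))\<^sup>2 * c = - (b\<^sup>2 * (c + 2)) / (c + 1)\<^sup>2"
  proof -
    have "2 * (- b / s) * b + (- b / s)\<^sup>2 * (s - 1) = - (b\<^sup>2 * (s + 1)) / s\<^sup>2" if "0 < s" for s
      using that by (simp add: divide_simps power2_eq_square) (simp add: algebra_simps)
    from this[of "c + 1"] c show ?thesis by (simp add: add.commute)
  qed
  with assms[of "- b / (c + 1)"] have "0 \<le> - (b\<^sup>2 * (c + 2)) / (c + 1)\<^sup>2" by simp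
  then have "b\<^sup>2 * (c + 2) \<le> 0" using c by (simp add: divide_le_0_iff)
  then have "b\<^sup>2 \<le> 0" using c by (simp add: mult_le_0_iff)
  then show ?thesis by simp
qed

text \<open>The quadratic form attains its maximum on the unit sphere of \<open>S\<close> by
  compactness, and a maximiser is an eigenvector.\<close>

lemma self_adjoint_eigenvector_exists:
  fixes f :: "'a::euclidean_space \<Rightarrow> 'a"
  assumes lin: "linear f" and sym: "\<And>x y. f x \<bullet> y = x \<bullet> f y"
    and S: "subspace S" "f ` S \<subseteq> S" "S \<noteq> {0}"
  obtains x m where "x \<in> S" "norm x = 1" "f x = m *\<^sub>R x"
proof -
  define K where "K = S \<inter> sphere 0 1"
  have "compact K" unfolding K_def
    by (intro closed_Int_compact closed_subspace S compact_sphere)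
  obtain y where "y \<in> S" "y \<noteq> 0" using S subspace_0 by blast
  then have "y /\<^sub>R norm y \<in> K" by (auto simp: K_def intro: subspace_scale S)
  then have "K \<noteq> {}" by blast
  moreover have "continuous_on K (\<lambda>x. x \<bullet> f x)"
    by (intro continuous_intros linear_continuous_on linear_conv_bounded_linear[THEN iffD1] lin)
  ultimately obtain x where x: "x \<in> K" and max: "\<And>y. y \<in> K \<Longrightarrow> y \<bullet> f y \<le> x \<bullet> f x"
    using continuous_attains_sup[OF \<open>compact K\<close>] by metis
  define m where "m = x \<bullet> f x"
  have xS: "x \<in> S" and nx: "norm x = 1" using x by (auto simp: K_def)
  have xx: "x \<bullet> x = 1" using nx by (simp add: dot_square_norm)
  have le: "z \<bullet> f z \<le> m * (z \<bullet> z)" if "z \<in> S" for z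
  proof (cases "z = 0")
    case False
    define y where "y = z /\<^sub>R norm z"
    have "y \<in> K" using that False S by (auto simp: K_def y_def intro: subspace_scale)
    then have *: "y \<bullet> f y \<le> m" using max m_def by simp
    have z: "z = norm z *\<^sub>R y" using False by (simp add: y_def)
    have "z \<bullet> f z = (norm z)\<^sup>2 * (y \<bullet> f y)"
      by (subst (1 2) z) (simp add: linear_scale[OF lin] power2_eq_square)
    also have "\<dots> \<le> (norm z)\<^sup>2 * m" using * by (intro mult_left_mono) auto
    finally show ?thesis by (simp add: dot_square_norm mult.commute)
  qed (simp add: linear_0[OF lin])
  \<comment> \<open>The form \<open>m * (z \<bullet> z) - z \<bullet> f z\<close> is nonnegative on
    \<open>S\<close> and vanishes at \<open>x\<close>, so its linear term at \<open>x\<close>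
    vanishes in every direction \<open>y\<close> of \<open>S\<close>. The residual is thus
    orthogonal to \<open>S\<close>; as it also lies in \<open>S\<close>, it is 0.\<close>
  have "(m *\<^sub>R x - f x) \<bullet> y = 0" if "y \<in> S" for y
  proof (rule nonneg_quadratic_imp_linear_coeff_zero)
    fix t :: real
    have "x + t *\<^sub>R y \<in> S" using xS that S by (simp add: subspace_add subspace_scale)
    from le[OF this] show "0 \<le> 2 * t * ((m *\<^sub>R x - f x) \<bullet> y) + t\<^sup>2 * (m * (y \<bullet> y) - y \<bullet> f y)"
      using sym[of x y] sym[of y x] xx
      by (simp add: linear_add[OF lin] linear_scale[OF lin] inner_simps algebra_simps
          power2_eq_square inner_commute m_def[symmetric])
  qed
  moreover have "m *\<^sub>R x - f x \<in> S" using xS S by (auto intro!: subspace_diff subspace_scale)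
  ultimately have "m *\<^sub>R x - f x = 0" using inner_eq_zero_iff by blast
  then show ?thesis using that[of x m] xS nx by simp
qed

text \<open>Induction on dimension: by self-adjointness the vectors of \<open>S\<close> orthogonal
  to one eigenvector form an invariant subspace, and it is strictly smaller.\<close>

lemma self_adjoint_orthonormal_eigenbasis:
  fixes f :: "'a::euclidean_space \<Rightarrow> 'a"
  assumes lin: "linear f" and sym: "\<And>x y. f x \<bullet> y = x \<bullet> f y"
    and S: "subspace S" "f ` S \<subseteq> S"
  shows "\<exists>B. pairwise orthogonal B \<and> (\<forall>x\<in>B. norm x = 1 \<and> (\<exists>m. f x = m *\<^sub>R x)) \<and> span B = S"
  using S
proof (induction "dim S" arbitrary: S rule: less_induct)
  case less
  show ?case
  proof (cases "S = {0}")
    case True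
    then show ?thesis by (intro exI[of _ "{}"]) auto
  next
    case False
    obtain x m where x: "x \<in> S" "norm x = 1" "f x = m *\<^sub>R x"
      using self_adjoint_eigenvector_exists[OF lin sym less.prems False] by blast
    define S' where "S' = {y \<in> S. orthogonal x y}"
    have sub: "subspace S'" unfolding S'_def using less.prems(1)
      by (auto simp: subspace_def orthogonal_def inner_simps)
    have inv: "f ` S' \<subseteq> S'" unfolding S'_def using less.prems(2) x(3) sym[of x]
      by (auto simp: orthogonal_def) (metis inner_scaleR_left mult_zero_right)
    have xn: "x \<notin> S'" using x(2) by (auto simp: S'_def orthogonal_def dot_square_norm)
    then have "S' \<subset> S" using x(1) by (auto simp: S'_def)
    then have "dim S' < dim S" using sub less.prems(1) by (intro dim_psubset) (metis span_eq_iff)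
    from less.hyps[OF this sub inv] obtain B where B: "pairwise orthogonal B"
      "\<forall>x\<in>B. norm x = 1 \<and> (\<exists>m. f x = m *\<^sub>R x)" "span B = S'" by blast
    have BS: "B \<subseteq> S'" using B(3) span_superset by blast
    have "pairwise orthogonal (insert x B)"
      using B(1) BS by (auto simp: pairwise_insert S'_def orthogonal_commute)
    moreover have "span (insert x B) = S"
    proof
      show "span (insert x B) \<subseteq> S"
        using x(1) BS less.prems(1) by (intro span_minimal) (auto simp: S'_def)
      show "S \<subseteq> span (insert x B)"
      proof
        fix y assume y: "y \<in> S"
        have "y - (x \<bullet> y) *\<^sub>R x \<in> S'"
          using x y less.prems(1)
          by (auto simp: S'_def orthogonal_def inner_simps dot_square_norm intro!: subspace_diff subspace_scale)
        then show "y \<in> span (insert x B)" using B(3) by (auto simp: span_insert)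
      qed
    qed
    ultimately show ?thesis using B(2) x by (intro exI[of _ "insert x B"]) auto
  qed
qed

theorem symmetric_matrix_diagonalizable:
  fixes M :: "real ^ 'n ^ 'n"
  assumes "transpose M = M"
  obtains P :: "real ^ 'n ^ 'n" and lam :: "'n \<Rightarrow> real"
  where "orthogonal_matrix P" "\<And>j. M *v column j P = lam j *\<^sub>R column j P"
proof -
  have "\<exists>B. pairwise orthogonal B \<and> (\<forall>x\<in>B. norm x = 1 \<and> (\<exists>m. M *v x = m *\<^sub>R x)) \<and> span B = UNIV"
    by (rule self_adjoint_orthonormal_eigenbasis)
      (auto simp: dot_lmul_matrix[symmetric] assms transpose_matrix_vector[symmetric])
  then obtain B where B: "pairwise orthogonal B"
      "\<And>x. x\<in>B \<Longrightarrow> norm x = 1" "\<And>x. x \<in> B \<Longrightarrow> \<exists>m. M *v x = m *\<^sub>R x" "span B = UNIV" by metis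
  have "independent B" using B(1,2) by (intro pairwise_orthogonal_independent) force+
  then have "card B = CARD('n)" "finite B"
    using B(4) by (metis dim_UNIV dim_eq_card_independent dim_span DIM_cart DIM_real mult.right_neutral,
        simp add: independent_imp_finite)
  then obtain b where b: "bij_betw b (UNIV :: 'n set) B"
    using finite_same_card_bij[of "UNIV :: 'n set" B] by auto
  define P :: "real ^ 'n ^ 'n" where "P = (\<chi> i j. b j $ i)"
  have col: "column j P = b j" for j by (simp add: P_def column_def vec_eq_iff)
  have bB: "b j \<in> B" for j using b by (auto simp: bij_betw_def)
  have "orthogonal_matrix P"
    unfolding orthogonal_matrix_orthonormal_columns col
  proof (intro conjI allI impI)
    show "norm (b i) = 1" for i using B(2)[OF bB] .
    fix i j :: 'n assume "i \<noteq> j"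
    then have "b i \<noteq> b j" using b by (auto simp: bij_betw_def inj_on_def)
    then show "orthogonal (b i) (b j)" using B(1) bB by (auto simp: pairwise_def)
  qed
  moreover obtain lam where "\<And>j. M *v b j = lam j *\<^sub>R b j" using B(3)[OF bB] by metis
  ultimately show ?thesis using that[of P lam] by (simp add: col)
qed

section \<open>Characteristic polynomials and similarity\<close>

lemma pCons_matrix_mult:
  fixes X Y :: "real ^ 'n ^ 'n"
  shows "(\<chi> i j. [:(X ** Y) $ i $ j:]) = (\<chi> i j. [:X $ i $ j:]) ** (\<chi> i j. [:Y $ i $ j:])"
proof -
  have *: "[:a + b:] = [:a:] + [:b:]" for a b :: real by simp
  have "[:sum g A:] = (\<Sum>k\<in>A. [:g k:])" for g :: "'n \<Rightarrow> real" and A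
    by (induction A rule: infinite_finite_induct) (simp_all add: * del: add_pCons)
  then show ?thesis by (simp add: matrix_matrix_mult_def vec_eq_iff mult.commute)
qed

lemma matrix_diff_ldistrib: "A ** (B - C) = A ** B - A ** (C :: 'a::ring_1 ^ 'n ^ 'm)"
  by (simp add: matrix_matrix_mult_def vec_eq_iff right_diff_distrib sum_subtractf)

lemma matrix_diff_rdistrib: "(A - B) ** C = A ** C - B ** (C :: 'a::ring_1 ^ 'n ^ 'm)"
  by (simp add: matrix_matrix_mult_def vec_eq_iff left_diff_distrib sum_subtractf)

text \<open>Computed over the polynomial ring: the entrywise embedding \<open>C\<close> of constants
  is multiplicative and the scalar matrix \<open>T\<close> commutes with \<open>C X\<close>, so the
  characteristic matrix is itself conjugated, and the determinants of \<open>C X\<close> and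
  \<open>C Y\<close> cancel.\<close>

lemma charpoly_similar:
  fixes X M Y :: "real ^ 'n ^ 'n"
  assumes "X ** Y = mat 1"
  shows "charpoly (X ** M ** Y) = charpoly M"
proof -
  define C :: "real ^ 'n ^ 'n \<Rightarrow> real poly ^ 'n ^ 'n" where "C A = (\<chi> i j. [:A $ i $ j:])" for A
  define T :: "real poly ^ 'n ^ 'n" where "T = mat [:0, 1:]"
  have C1: "C (mat 1) = mat 1" by (simp add: C_def mat_def vec_eq_iff one_pCons)
  have Cm: "C (A ** B) = C A ** C B" for A B unfolding C_def by (rule pCons_matrix_mult)
  have T: "C X ** T ** C Y = T"
  proof -
    have "C X ** T = T ** C X"
      by (simp add: vec_eq_iff T_def mat_def matrix_matrix_mult_def if_distrib if_distribR
          sum.delta sum.delta' mult.commute cong: if_cong)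
    then have "C X ** T ** C Y = T ** (C X ** C Y)" by (simp add: matrix_mul_assoc)
    then show ?thesis using assms C1 by (simp add: Cm[symmetric])
  qed
  have "T - C (X ** M ** Y) = C X ** (T - C M) ** C Y"
    using T by (simp add: Cm matrix_diff_ldistrib matrix_diff_rdistrib)
  then have "det (T - C (X ** M ** Y)) = det (C X) * det (C Y) * det (T - C M)"
    by (simp add: det_mul)
  also have "det (C X) * det (C Y) = 1"
    by (metis C1 Cm assms det_I det_mul)
  finally show ?thesis by (simp add: charpoly_def T_def C_def)
qed

lemma charpoly_diagonal:
  fixes lam :: "'n::finite \<Rightarrow> real"
  shows "charpoly (\<chi> i j. if i = j then lam i else 0) = (\<Prod>i\<in>UNIV. [:- lam i, 1:])"
  unfolding charpoly_def by (subst det_diagonal) (auto simp: mat_def)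

text \<open>Ties \<open>eigval\<close>, which is defined by roots of a polynomial, to an eigenbasis:
  \<open>P\<close> conjugates \<open>M\<close> to the diagonal matrix of the \<open>lam j\<close>,
  so multiplicities agree as well.\<close>

lemma proots_charpoly_eigenbasis:
  fixes P M :: "real ^ 'n ^ 'n"
  assumes "orthogonal_matrix P" "\<And>j. M *v column j P = lam j *\<^sub>R column j P"
  shows "proots (charpoly M) = image_mset lam (mset_set UNIV)"
proof -
  let ?D = "\<chi> i j. if i = j then lam i else 0"
  have PT: "transpose P ** P = mat 1" "P ** transpose P = mat 1"
    using assms(1) by (auto simp: orthogonal_matrix_def)
  have "M ** P = P ** ?D"
  proof -
    have "(M ** P) $ i $ j = (P ** ?D) $ i $ j" for i j
    proof -
      have "(M ** P) $ i $ j = (M *v column j P) $ i"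
        by (simp add: matrix_matrix_mult_def matrix_vector_mult_def column_def)
      also have "\<dots> = lam j * P $ i $ j" by (simp only: assms(2)) (simp add: column_def)
      finally show ?thesis
        by (simp add: matrix_matrix_mult_def if_distrib sum.delta mult.commute cong: if_cong)
    qed
    then show ?thesis by (simp add: vec_eq_iff)
  qed
  then have "transpose P ** M ** P = transpose P ** P ** ?D"
    by (simp flip: matrix_mul_assoc)
  then have "charpoly M = charpoly ?D" using charpoly_similar[OF PT(1), of M] PT(1) by simp
  then show ?thesis
    by (simp add: charpoly_diagonal proots_prod sum_unfold_sum_mset)
qed

lemma length_sorted_proots_eigenbasis:
  fixes P M :: "real ^ 'n ^ 'n"
  assumes "orthogonal_matrix P" "\<And>j. M *v column j P = lam j *\<^sub>R column j P"
  shows "length (sorted_list_of_multiset (proots (charpoly M))) = CARD('n)"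
    and "set (sorted_list_of_multiset (proots (charpoly M))) = range lam"
proof -
  have "mset (sorted_list_of_multiset (proots (charpoly M))) = image_mset lam (mset_set UNIV)"
    using proots_charpoly_eigenbasis[OF assms] by simp
  from arg_cong[OF this, of size, unfolded size_mset] arg_cong[OF this, of set_mset]
  show "length (sorted_list_of_multiset (proots (charpoly M))) = CARD('n)"
    and "set (sorted_list_of_multiset (proots (charpoly M))) = range lam"
    by simp_all
qed

section \<open>Ordered eigenvalues and the min-max principle\<close>

lemma eigval_symmetric_eigenvector:
  fixes M :: "real ^ 'n ^ 'n"
  assumes "transpose M = M" "k \<in> {1..CARD('n)}"
  obtains x where "norm x = 1" "M *v x = eigval k M *\<^sub>R x"
proof -
  obtain P lam where P: "orthogonal_matrix P" "\<And>j. M *v column j P = lam j *\<^sub>R column j P"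
    using symmetric_matrix_diagonalizable[OF assms(1)] by blast
  have "eigval k M \<in> set (sorted_list_of_multiset (proots (charpoly M)))"
    unfolding eigval_def using length_sorted_proots_eigenbasis(1)[OF P] assms(2)
    by (intro nth_mem) auto
  then obtain j where j: "eigval k M = lam j"
    using length_sorted_proots_eigenbasis(2)[OF P] by auto
  have "norm (column j P) = 1"
    using P(1) by (simp add: orthogonal_matrix_orthonormal_columns)
  then show ?thesis using that P(2) j by simp
qed

lemma eigval_symmetric_mono:
  fixes M :: "real ^ 'n ^ 'n"
  assumes "transpose M = M" "1 \<le> j" "j \<le> k" "k \<le> CARD('n)"
  shows "eigval j M \<le> eigval k M"
proof -
  obtain P lam where P: "orthogonal_matrix P" "\<And>j. M *v column j P = lam j *\<^sub>R column j P"
    using symmetric_matrix_diagonalizable[OF assms(1)] by blast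
  show ?thesis
    unfolding eigval_def using length_sorted_proots_eigenbasis(1)[OF P] assms(2-4)
    by (intro sorted_nth_mono) auto
qed

text \<open>In the sorted list all entries up to \<open>c\<close> sit at positions below
  \<open>m\<close>. It is applied with \<open>m = k - 1\<close>, since positions start at 0 and
  eigenvalues are numbered from 1.\<close>

lemma card_le_of_sorted_nth_gt:
  fixes lam :: "'n::finite \<Rightarrow> real"
  assumes "mset xs = image_mset lam (mset_set UNIV)" "sorted xs" "c < xs ! m" "m < length xs"
  shows "card {j. lam j \<le> c} \<le> m"
proof -
  have "card {j. lam j \<le> c} = size (filter_mset (\<lambda>x. x \<le> c) (mset xs))"
    by (simp add: assms(1) filter_mset_image_mset)
  also have "\<dots> = card {i. i < length xs \<and> xs ! i \<le> c}"
    by (simp add: length_filter_conv_card flip: mset_filter)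
  also have "\<dots> \<le> card {..<m}"
  proof (rule card_mono)
    show "{i. i < length xs \<and> xs ! i \<le> c} \<subseteq> {..<m}"
    proof
      fix i assume i: "i \<in> {i. i < length xs \<and> xs ! i \<le> c}"
      show "i \<in> {..<m}"
      proof (rule ccontr)
        assume "i \<notin> {..<m}"
        then have "xs ! m \<le> xs ! i" using i assms(2) by (intro sorted_nth_mono) auto
        then show False using i assms(3) by simp
      qed
    qed
  qed simp
  finally show ?thesis by simp
qed

lemma inner_orthonormal_columns_expansion:
  fixes P M :: "real ^ 'n ^ 'n"
  assumes "orthogonal_matrix P" "\<And>j. M *v column j P = lam j *\<^sub>R column j P"
  shows "x \<bullet> x = (\<Sum>j\<in>UNIV. (x \<bullet> column j P)\<^sup>2)"
    and "x \<bullet> (M *v x) = (\<Sum>j\<in>UNIV. lam j * (x \<bullet> column j P)\<^sup>2)"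
proof -
  define y where "y = transpose P *v x"
  have y: "y $ j = x \<bullet> column j P" for j
    by (simp add: y_def matrix_vector_mult_def transpose_def column_def inner_vec_def mult.commute)
  have "x = P *v y"
    using assms(1) unfolding y_def orthogonal_matrix_def matrix_vector_mul_assoc by simp
  then have x: "x = (\<Sum>j\<in>UNIV. (x \<bullet> column j P) *\<^sub>R column j P)"
    by (subst (asm) matrix_mult_sum) (simp add: y scalar_mult_eq_scaleR)
  have Mx: "M *v x = (\<Sum>j\<in>UNIV. (x \<bullet> column j P) *\<^sub>R lam j *\<^sub>R column j P)"
    by (subst x) (simp add: vec.linear_sum[OF matrix_vector_mul_linear_gen] matrix_vector_mult_scaleR assms(2))
  show "x \<bullet> x = (\<Sum>j\<in>UNIV. (x \<bullet> column j P)\<^sup>2)"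
    by (subst (2) x) (simp add: inner_sum_right power2_eq_square)
  show "x \<bullet> (M *v x) = (\<Sum>j\<in>UNIV. lam j * (x \<bullet> column j P)\<^sup>2)"
    by (simp add: Mx inner_sum_right power2_eq_square mult_ac)
qed

text \<open>The upper-bound half of Courant-Fischer. Were the k-th eigenvalue above
  \<open>c\<close>, fewer than \<open>k\<close> eigenvectors would have eigenvalue at most
  \<open>c\<close>; then \<open>S\<close> contains a nonzero vector orthogonal to all of these, and
  on it the form exceeds \<open>c * (x \<bullet> x)\<close>.\<close>

theorem eigval_symmetric_le:
  fixes M :: "real ^ 'n ^ 'n"
  assumes "transpose M = M" "1 \<le> k" "subspace S" "k \<le> dim S"
    and le: "\<And>x. x \<in> S \<Longrightarrow> x \<bullet> (M *v x) \<le> c * (x \<bullet> x)"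
  shows "eigval k M \<le> c"
proof (rule ccontr)
  assume gt: "\<not> eigval k M \<le> c"
  obtain P lam where P: "orthogonal_matrix P" "\<And>j. M *v column j P = lam j *\<^sub>R column j P"
    using symmetric_matrix_diagonalizable[OF assms(1)] by blast
  let ?J = "{j. lam j \<le> c}"
  have kN: "k \<le> CARD('n)" using assms(4) dim_subset_UNIV[of S] by simp
  have "card ?J \<le> k - 1"
  proof (rule card_le_of_sorted_nth_gt)
    show "mset (sorted_list_of_multiset (proots (charpoly M))) = image_mset lam (mset_set UNIV)"
      using proots_charpoly_eigenbasis[OF P] by simp
    show "k - 1 < length (sorted_list_of_multiset (proots (charpoly M)))"
      using length_sorted_proots_eigenbasis(1)[OF P] kN assms(2) by simp
  qed (use gt in \<open>simp_all add: eigval_def\<close>)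
  moreover define A where "A = span ((\<lambda>j. column j P) ` ?J)"
  have "dim A \<le> card ?J"
    unfolding A_def dim_span by (rule order_trans[OF dim_le_card' card_image_le]) simp_all
  ultimately have A: "dim A < k" using assms(2) by simp
  define T where "T = {y \<in> UNIV. \<forall>x\<in>A. orthogonal x y}"
  have "dim T + dim A = CARD('n)"
    using dim_subspace_orthogonal_to_vectors[of A UNIV] by (simp add: A_def T_def)
  moreover have sT: "subspace T"
    by (auto simp: T_def subspace_def orthogonal_def inner_simps)
  then have "dim {x + y |x y. x \<in> S \<and> y \<in> T} + dim (S \<inter> T) = dim S + dim T"
    by (rule dim_sums_Int[OF assms(3)])
  moreover have "dim {x + y |x y. x \<in> S \<and> y \<in> T} \<le> CARD('n)"
    using dim_subset_UNIV[of "{x + y |x y. x \<in> S \<and> y \<in> T}"] by simp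
  \<comment> \<open>The dimensions of \<open>S\<close> and \<open>T\<close> add up to at least
    \<open>k + CARD('n) - dim A\<close>, which exceeds that of the whole space.\<close>
  ultimately have "0 < dim (S \<inter> T)" using A assms(4) by linarith
  then have "\<not> S \<inter> T \<subseteq> {0}" by (simp flip: dim_eq_0)
  then obtain x where x: "x \<in> S" "x \<in> T" "x \<noteq> 0" by blast
  have zero: "x \<bullet> column j P = 0" if "j \<in> ?J" for j
  proof -
    have "column j P \<in> A" unfolding A_def using that by (intro span_base) blast
    then show ?thesis using x(2) by (auto simp: T_def orthogonal_def inner_commute)
  qed
  note exp = inner_orthonormal_columns_expansion[OF P]
  have "(\<Sum>j\<in>UNIV. (x \<bullet> column j P)\<^sup>2) \<noteq> 0" using x(3) by (simp flip: exp(1))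
  then obtain j0 where "(x \<bullet> column j0 P)\<^sup>2 \<noteq> 0" by (rule sum.not_neutral_contains_not_neutral)
  then have j0: "x \<bullet> column j0 P \<noteq> 0" by simp
  have "c * (x \<bullet> x) = (\<Sum>j\<in>UNIV. c * (x \<bullet> column j P)\<^sup>2)" by (simp add: exp(1) sum_distrib_left)
  also have "\<dots> < (\<Sum>j\<in>UNIV. lam j * (x \<bullet> column j P)\<^sup>2)"
  proof (rule sum_strict_mono_ex1)
    show "\<forall>j\<in>UNIV. c * (x \<bullet> column j P)\<^sup>2 \<le> lam j * (x \<bullet> column j P)\<^sup>2"
    proof
      fix j show "c * (x \<bullet> column j P)\<^sup>2 \<le> lam j * (x \<bullet> column j P)\<^sup>2"
        using zero[of j] by (cases "lam j \<le> c") (auto intro: mult_right_mono)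
    qed
    have "c < lam j0" using zero[of j0] j0 by force
    then show "\<exists>j\<in>UNIV. c * (x \<bullet> column j P)\<^sup>2 < lam j * (x \<bullet> column j P)\<^sup>2"
      using j0 by (intro bexI[of _ j0]) auto
  qed simp
  also have "\<dots> = x \<bullet> (M *v x)" by (simp add: exp(2))
  finally show False using le[OF x(1)] by simp
qed

section \<open>Tent functions and antiderivatives\<close>

text \<open>The piece of a function between the levels \<open>a\<close> and \<open>b\<close>. It is
  made odd so that composing with it commutes with multiplication by edge signs.\<close>

definition tent :: "real \<Rightarrow> real \<Rightarrow> real \<Rightarrow> real" where
  "tent a b x = sgn x * max 0 (min (\<bar>x\<bar> - a) (b - \<bar>x\<bar>))"

text \<open>For negative \<open>a\<close> the factor \<open>sgn\<close> could make the function jump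
  at 0.\<close>

lemma tent_lipschitz:
  assumes "0 \<le> a"
  shows "\<bar>tent a b x - tent a b y\<bar> \<le> \<bar>x - y\<bar>"
  using assms by (auto simp: tent_def sgn_if max_def min_def abs_if)

lemma tent_mult_sign: "c = 1 \<or> c = -1 \<Longrightarrow> tent a b (c * x) = c * tent a b x"
  by (auto simp: tent_def)

lemma tent_nonzeroD: "tent a b x \<noteq> 0 \<Longrightarrow> a < \<bar>x\<bar> \<and> \<bar>x\<bar> < b"
  by (auto simp: tent_def max_def min_def split: if_splits)

lemma tent_eq_sgn: "a \<le> \<bar>x\<bar> \<Longrightarrow> \<bar>x\<bar> \<le> b \<Longrightarrow> tent a b x = sgn x * min (\<bar>x\<bar> - a) (b - \<bar>x\<bar>)"
  by (auto simp: tent_def)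

lemma tent_same [simp]: "tent a a x = 0"
  by (auto simp: tent_def)

lemma tent_index_unique:
  assumes "incseq t" "tent (t i) (t (Suc i)) x \<noteq> 0" "tent (t j) (t (Suc j)) x \<noteq> 0"
  shows "i = j"
proof (rule ccontr)
  assume "i \<noteq> j"
  then consider "Suc i \<le> j" | "Suc j \<le> i" by linarith
  then show False
    using tent_nonzeroD[OF assms(2)] tent_nonzeroD[OF assms(3)] incseqD[OF assms(1)]
    by cases force+
qed

section \<open>Finite sums with few nonzero or few large terms\<close>

lemma card_le_Suc_0I:
  assumes "\<And>x y. x \<in> A \<Longrightarrow> y \<in> A \<Longrightarrow> x = y"
  shows "card A \<le> Suc 0"
  using assms by (cases "finite A") (auto simp: card_le_Suc0_iff_eq)

text \<open>\<open>p\<close> and \<open>q\<close> will be the values of a disjointly supported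
  family at the two ends of an edge. Each end meets at most one member, so the edge meets at most
  two; the factors 2 in the energy estimates come from here.\<close>

lemma card_nonzero_diff_le_two:
  fixes p q :: "'i \<Rightarrow> real"
  assumes "\<And>i j. p i \<noteq> 0 \<Longrightarrow> p j \<noteq> 0 \<Longrightarrow> i = j" "\<And>i j. q i \<noteq> 0 \<Longrightarrow> q j \<noteq> 0 \<Longrightarrow> i = j" "finite I"
  shows "card {i \<in> I. p i - c * q i \<noteq> 0} \<le> 2"
proof -
  have "card {i \<in> I. p i - c * q i \<noteq> 0} \<le> card ({i \<in> I. p i \<noteq> 0} \<union> {i \<in> I. q i \<noteq> 0})"
    using assms(3) by (intro card_mono) auto
  also have "\<dots> \<le> card {i \<in> I. p i \<noteq> 0} + card {i \<in> I. q i \<noteq> 0}" by (rule card_Un_le)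
  also have "card {i \<in> I. p i \<noteq> 0} \<le> Suc 0" using assms(1) by (intro card_le_Suc_0I) auto
  also have "card {i \<in> I. q i \<noteq> 0} \<le> Suc 0" using assms(2) by (intro card_le_Suc_0I) auto
  finally show ?thesis by simp
qed

lemma square_sum_le_two_sum_squares:
  fixes y :: "'i \<Rightarrow> real"
  assumes "finite I" "card {i \<in> I. y i \<noteq> 0} \<le> 2"
  shows "(\<Sum>i\<in>I. y i)\<^sup>2 \<le> 2 * (\<Sum>i\<in>I. (y i)\<^sup>2)"
proof -
  let ?J = "{i \<in> I. y i \<noteq> 0}"
  have "(\<Sum>i\<in>I. y i) = (\<Sum>i\<in>?J. y i)" "(\<Sum>i\<in>I. (y i)\<^sup>2) = (\<Sum>i\<in>?J. (y i)\<^sup>2)"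
    using assms(1) by (auto intro!: sum.mono_neutral_right)
  moreover have "(\<Sum>i\<in>?J. y i)\<^sup>2 \<le> (\<Sum>i\<in>?J. (y i)\<^sup>2) * card ?J"
    by (rule sum_squared_le_sum_of_squares)
  moreover have "\<dots> \<le> (\<Sum>i\<in>?J. (y i)\<^sup>2) * 2"
    using assms(2) by (intro mult_left_mono sum_nonneg) auto
  ultimately show ?thesis by simp
qed

lemma sum_squares_le_two_bound:
  fixes y :: "'i \<Rightarrow> real"
  assumes "finite I" "card {i \<in> I. y i \<noteq> 0} \<le> 2" "\<And>i. i \<in> I \<Longrightarrow> \<bar>y i\<bar> \<le> \<bar>b\<bar>"
  shows "(\<Sum>i\<in>I. (y i)\<^sup>2) \<le> 2 * b\<^sup>2"
proof -
  let ?J = "{i \<in> I. y i \<noteq> 0}"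
  have "(\<Sum>i\<in>I. (y i)\<^sup>2) = (\<Sum>i\<in>?J. (y i)\<^sup>2)"
    using assms(1) by (auto intro!: sum.mono_neutral_right)
  also have "\<dots> \<le> real (card ?J) * b\<^sup>2"
  proof (rule sum_bounded_above)
    show "(y i)\<^sup>2 \<le> b\<^sup>2" if "i \<in> ?J" for i
      using assms(3)[of i] that by (simp add: abs_le_square_iff)
  qed
  also have "\<dots> \<le> 2 * b\<^sup>2" using assms(2) by (intro mult_right_mono) auto
  finally show ?thesis .
qed

text \<open>Markov's inequality: more than \<open>k\<close> terms above \<open>b / k\<close> would
  already sum to more than \<open>b\<close>.\<close>

lemma many_small_terms:
  fixes y :: "nat \<Rightarrow> real"
  assumes "\<And>i. i < 2 * k \<Longrightarrow> 0 \<le> y i" "(\<Sum>i<2 * k. y i) \<le> b" "0 < k"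
  obtains I where "I \<subseteq> {..<2 * k}" "card I = k" "\<And>i. i \<in> I \<Longrightarrow> y i \<le> b / k"
proof -
  let ?G = "{i \<in> {..<2 * k}. y i \<le> b / k}" and ?B = "{i \<in> {..<2 * k}. \<not> y i \<le> b / k}"
  have "card ?B \<le> k"
  proof (rule ccontr)
    assume c: "\<not> card ?B \<le> k"
    then have ne: "?B \<noteq> {}"
    proof (intro notI)
      assume e: "?B = {}"
      show False using c unfolding e by simp
    qed
    have "b = k * (b / k)" using assms(3) by simp
    also have "\<dots> \<le> card ?B * (b / k)"
    proof (rule mult_right_mono)
      show "0 \<le> b / k" using assms(1,2) sum_nonneg[of "{..<2*k}" y] by auto
    qed (use c in auto)
    also have "\<dots> = (\<Sum>i\<in>?B. b / k)" by simp
    also have "\<dots> < (\<Sum>i\<in>?B. y i)" using ne by (intro sum_strict_mono) auto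
    also have "\<dots> \<le> (\<Sum>i<2 * k. y i)" using assms(1) by (intro sum_mono2) auto
    finally show False using assms(2) by simp
  qed
  moreover have "card ?G + card ?B = 2 * k"
  proof -
    have "{..<2 * k} = ?G \<union> ?B" by auto
    then have "card {..<2 * k} = card (?G \<union> ?B)" by (rule arg_cong)
    also have "\<dots> = card ?G + card ?B" by (rule card_Un_disjoint) auto
    finally show ?thesis by simp
  qed
  ultimately have "k \<le> card ?G" by linarith
  then obtain I where "I \<subseteq> ?G" "card I = k" by (rule obtain_subset_with_card_n)
  then show ?thesis using that[of I] by auto
qed

section \<open>Bracketing by thresholds, and antiderivatives of the distance to them\<close>

lemma incseq_bracket:
  fixes t :: "nat \<Rightarrow> real"
  assumes "t 0 \<le> x" "x \<le> t n" "0 < n"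
  shows "\<exists>i<n. t i \<le> x \<and> x \<le> t (Suc i)"
  using assms(3,2)
proof (induction n rule: nat_induct_non_zero)
  case 1
  then show ?case using assms(1) by auto
next
  case (Suc n)
  then show ?case by (cases "x \<le> t n") (auto simp: less_Suc_eq)
qed

text \<open>Normalise the antiderivative to vanish at 0; as the integrand is even,
  \<open>F (- x) + F x\<close> has derivative 0. Oddness will let edge signs pass through
  \<open>F\<close>.\<close>

lemma continuous_odd_antiderivative:
  fixes \<eta> :: "real \<Rightarrow> real"
  assumes "\<And>x. isCont \<eta> x" and even: "\<And>x. \<eta> (- x) = \<eta> x"
  obtains F where "\<And>x. (F has_real_derivative \<eta> x) (at x)" "\<And>x. F (- x) = - F x"
proof -
  obtain G where G: "\<And>x. (G has_real_derivative \<eta> x) (at x)"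
    using einterval_antiderivative[of "-\<infinity>" \<infinity> \<eta>] assms(1)
    by (auto simp: has_real_derivative_iff_has_vector_derivative)
  define F where "F x = G x - G 0" for x
  have F: "(F has_real_derivative \<eta> x) (at x)" for x
    unfolding F_def using G[of x] by (auto intro!: derivative_eq_intros)
  have "((\<lambda>x. F (- x) + F x) has_real_derivative 0) (at x)" for x
    using F[of x] DERIV_chain2[OF F[of "- x"] DERIV_minus[OF DERIV_ident], of UNIV] even
    by (auto intro!: derivative_eq_intros)
  then have "F (- x) + F x = F (- 0) + F 0" for x
    using DERIV_isconst_all[of "\<lambda>x. F (- x) + F x"] by metis
  moreover have "F 0 = 0" by (simp add: F_def)
  ultimately have "F (- x) = - F x" for x by (simp add: eq_neg_iff_add_eq_0)
  then show ?thesis using that F by blast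
qed

text \<open>At the point \<open>z\<close> of the mean value theorem, average the Lipschitz bounds
  for \<open>\<eta> z\<close> from \<open>a\<close> and from \<open>b\<close>; the distances from
  \<open>z\<close> to the two ends add up to \<open>\<bar>a - b\<bar>\<close>.\<close>

lemma antiderivative_lipschitz_diff_bound:
  fixes F \<eta> :: "real \<Rightarrow> real"
  assumes F: "\<And>x. (F has_real_derivative \<eta> x) (at x)"
    and lip: "\<And>x y. \<eta> x \<le> \<eta> y + \<bar>x - y\<bar>" and nonneg: "\<And>x. 0 \<le> \<eta> x"
  shows "\<bar>F a - F b\<bar> \<le> \<bar>a - b\<bar> * (\<eta> a + \<eta> b + \<bar>a - b\<bar>) / 2"
proof -
  have *: "\<bar>F a - F b\<bar> \<le> \<bar>a - b\<bar> * (\<eta> a + \<eta> b + \<bar>a - b\<bar>) / 2" if ab: "a < b" for a b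
  proof -
    obtain z where z: "a < z" "z < b" "F b - F a = (b - a) * \<eta> z"
      using MVT2[OF ab, of F \<eta>] F by blast
    have "\<eta> z \<le> (\<eta> a + \<eta> b + \<bar>a - b\<bar>) / 2"
      using lip[of z a] lip[of z b] z by auto
    then have "(b - a) * \<eta> z \<le> (b - a) * ((\<eta> a + \<eta> b + \<bar>a - b\<bar>) / 2)"
      using that by (intro mult_left_mono) auto
    moreover have "0 \<le> (b - a) * \<eta> z" using that nonneg by simp
    ultimately have "\<bar>F b - F a\<bar> \<le> (b - a) * ((\<eta> a + \<eta> b + \<bar>a - b\<bar>) / 2)"
      using z(3) by simp
    then show ?thesis using that by (simp add: abs_minus_commute)
  qed
  show ?thesis
    using *[of a b] *[of b a]
    by (cases a b rule: linorder_cases) (simp_all add: abs_minus_commute add.commute)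
qed

text \<open>Cauchy-Schwarz for \<open>i\<close> equal parts of \<open>p\<close> and one part
  \<open>q\<close>; after clearing denominators the defect is the square of
  \<open>p - q * i\<close>. For \<open>i = 0\<close> the term \<open>p\<^sup>2 / real i\<close> is
  0, hence the hypothesis.\<close>

lemma square_div_add_square:
  fixes p q :: real
  assumes "i = 0 \<longrightarrow> p = 0"
  shows "(p + q)\<^sup>2 / real (Suc i) \<le> p\<^sup>2 / real i + q\<^sup>2"
proof (cases "i = 0")
  case False
  have "(p + q)\<^sup>2 * i \<le> (p\<^sup>2 + q\<^sup>2 * i) * (i + 1)"
  proof -
    have "(p\<^sup>2 + q\<^sup>2 * i) * (i + 1) - (p + q)\<^sup>2 * i = (p - q * i)\<^sup>2"
      by (simp add: power2_eq_square algebra_simps)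
    then show ?thesis by (metis diff_ge_0_iff_ge zero_le_power2)
  qed
  then show ?thesis using False by (simp add: field_simps)
qed (use assms in simp)

text \<open>The right-hand side is at least the area of the triangle with base \<open>x - a\<close>
  and slopes 1 and -1. The two halves are compared with explicit parabolas on either side of the
  midpoint.\<close>

lemma antiderivative_tent_ge:
  fixes F \<eta> :: "real \<Rightarrow> real"
  assumes F: "\<And>x. (F has_real_derivative \<eta> x) (at x)"
    and ge: "\<And>y. a \<le> y \<Longrightarrow> y \<le> x \<Longrightarrow> min (y - a) (x - y) \<le> \<eta> y" and "a \<le> x"
  shows "(x - a)\<^sup>2 / 4 \<le> F x - F a"
proof -
  define m where "m = (a + x) / 2"
  have "F a - (a - a)\<^sup>2 / 2 \<le> F m - (m - a)\<^sup>2 / 2"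
  proof (rule DERIV_nonneg_imp_nondecreasing[where f = "\<lambda>y. F y - (y - a)\<^sup>2 / 2"])
    fix y assume "a \<le> y" "y \<le> m"
    then have "0 \<le> \<eta> y - (y - a)" using ge[of y] \<open>a \<le> x\<close> by (auto simp: m_def min_def split: if_splits)
    moreover have "((\<lambda>y. F y - (y - a)\<^sup>2 / 2) has_real_derivative \<eta> y - (y - a)) (at y)"
      using F[of y] by (auto intro!: derivative_eq_intros simp: field_simps)
    ultimately show "\<exists>z. ((\<lambda>y. F y - (y - a)\<^sup>2 / 2) has_real_derivative z) (at y) \<and> 0 \<le> z" by blast
  qed (use \<open>a \<le> x\<close> in \<open>simp add: m_def\<close>)
  moreover have "F m + (x - m)\<^sup>2 / 2 \<le> F x + (x - x)\<^sup>2 / 2"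
  proof (rule DERIV_nonneg_imp_nondecreasing[where f = "\<lambda>y. F y + (x - y)\<^sup>2 / 2"])
    fix y assume "m \<le> y" "y \<le> x"
    then have "0 \<le> \<eta> y - (x - y)" using ge[of y] \<open>a \<le> x\<close> by (auto simp: m_def min_def split: if_splits)
    moreover have "((\<lambda>y. F y + (x - y)\<^sup>2 / 2) has_real_derivative \<eta> y - (x - y)) (at y)"
      using F[of y] by (auto intro!: derivative_eq_intros)
    ultimately show "\<exists>z. ((\<lambda>y. F y + (x - y)\<^sup>2 / 2) has_real_derivative z) (at y) \<and> 0 \<le> z" by blast
  qed (use \<open>a \<le> x\<close> in \<open>simp add: m_def\<close>)
  moreover have "(m - a)\<^sup>2 / 2 + (x - m)\<^sup>2 / 2 = (x - a)\<^sup>2 / 4"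
    by (simp add: m_def field_simps power2_eq_square)
  ultimately show ?thesis by simp
qed

text \<open>Each gap of length g below \<open>x\<close> contributes at least g^2 / 4, and at most
  \<open>n\<close> gaps add up to \<open>x\<close>, so Cauchy-Schwarz gives the bound. The induction
  adds one gap at a time.\<close>

lemma threshold_distance_antiderivative_ge:
  fixes F \<eta> :: "real \<Rightarrow> real" and t :: "nat \<Rightarrow> real"
  assumes F: "\<And>x. (F has_real_derivative \<eta> x) (at x)" and "F 0 = 0" "incseq t" "t 0 = 0"
    and ge: "\<And>i y. i < n \<Longrightarrow> t i \<le> y \<Longrightarrow> y \<le> t (Suc i) \<Longrightarrow> min (y - t i) (t (Suc i) - y) \<le> \<eta> y"
    and "0 \<le> x" "x \<le> t n"
  shows "x\<^sup>2 / (4 * real n) \<le> F x"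
  using ge assms(6,7)
proof (induction n arbitrary: x)
  case 0
  then show ?case using assms(2,4) by simp
next
  case (Suc n)
  have mono: "x\<^sup>2 / (4 * real (Suc n)) \<le> F x" if "0 \<le> x" "x \<le> t n" for x
  proof (cases "n = 0")
    case True
    then show ?thesis using that assms(2,4) by simp
  next
    case False
    have "x\<^sup>2 / (4 * real (Suc n)) \<le> x\<^sup>2 / (4 * real n)"
      using False by (intro divide_left_mono) auto
    also have "\<dots> \<le> F x" using Suc.IH[of x] Suc.prems(1) that by simp
    finally show ?thesis .
  qed
  show ?case
  proof (cases "x \<le> t n")
    case True
    then show ?thesis using mono Suc.prems by simp
  next
    case False
    \<comment> \<open>In the last, incomplete gap a smaller triangle ending at \<open>x\<close> is
      used; it lies below the one ending at \<open>t (Suc n)\<close>.\<close>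
    have "(x - t n)\<^sup>2 / 4 \<le> F x - F (t n)"
    proof (rule antiderivative_tent_ge[OF F])
      fix y assume "t n \<le> y" "y \<le> x"
      then show "min (y - t n) (x - y) \<le> \<eta> y" using Suc.prems(1)[of n y] Suc.prems(3) by auto
    qed (use False in simp)
    moreover have "0 \<le> t n" using incseqD[OF assms(3), of 0 n] assms(4) by simp
    then have "(t n)\<^sup>2 / (4 * real n) \<le> F (t n)"
      using Suc.IH[of "t n"] Suc.prems(1) by simp
    moreover have "(t n + (x - t n))\<^sup>2 / real (Suc n) \<le> (t n)\<^sup>2 / real n + (x - t n)\<^sup>2"
      using assms(4) by (intro square_div_add_square) auto
    ultimately have *: "x\<^sup>2 / real (Suc n) \<le> 4 * F x" by (simp del: of_nat_Suc)
    have "x\<^sup>2 / (4 * real (Suc n)) = 1 / 4 * (x\<^sup>2 / real (Suc n))" by simp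
    also have "\<dots> \<le> 1 / 4 * (4 * F x)" using * by (intro mult_left_mono) auto
    finally show ?thesis by simp
  qed
qed

text \<open>Moving both numbers towards 0 by \<open>m\<close> makes neither cross 0, so the distance
  splits additively. This is the identity behind one peeling step of the coarea inequality.\<close>

lemma abs_diff_truncate:
  fixes a b m :: real
  assumes "0 \<le> m" "a \<noteq> 0 \<Longrightarrow> m \<le> \<bar>a\<bar>" "b \<noteq> 0 \<Longrightarrow> m \<le> \<bar>b\<bar>"
  shows "\<bar>a - b\<bar> = \<bar>(a - m * sgn a) - (b - m * sgn b)\<bar> + m * \<bar>sgn a - sgn b\<bar>"
  using assms by (auto simp: sgn_if abs_if split: if_splits)

section \<open>Energy and variation on a signed weighted graph\<close>

text \<open>Edge sets are abstracted away: signs are total, non-edges have weight 0, and sums run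
  over all ordered pairs.\<close>

locale signed_weights =
  fixes w s :: "'v::finite \<Rightarrow> 'v \<Rightarrow> real" and d :: "'v \<Rightarrow> real"
  assumes w_nonneg: "0 \<le> w u v" and w_sym: "w u v = w v u"
    and s_sym: "s u v = s v u" and s_sign: "s u v = 1 \<or> s u v = -1"
    and d_eq: "d u = (\<Sum>v\<in>UNIV. w u v)" and d_pos: "0 < d u"
begin

definition mass :: "('v \<Rightarrow> real) \<Rightarrow> real" where
  "mass f = (\<Sum>u\<in>UNIV. d u * (f u)\<^sup>2)"

text \<open>The Dirichlet form of the signed Laplacian; each edge occurs in both orders, hence the
  division by 2.\<close>

definition energy :: "('v \<Rightarrow> real) \<Rightarrow> real" where
  "energy f = (\<Sum>u\<in>UNIV. \<Sum>v\<in>UNIV. w u v * (f u - s u v * f v)\<^sup>2) / 2"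

definition variation :: "('v \<Rightarrow> real) \<Rightarrow> real" where
  "variation f = (\<Sum>u\<in>UNIV. \<Sum>v\<in>UNIV. w u v * \<bar>f u - s u v * f v\<bar>) / 2"

lemma energy_nonneg: "0 \<le> energy f"
  unfolding energy_def by (intro divide_nonneg_pos sum_nonneg) (auto simp: w_nonneg)

lemma variation_nonneg: "0 \<le> variation f"
  unfolding variation_def by (intro divide_nonneg_pos sum_nonneg) (auto simp: w_nonneg)

lemma sum_weights_endpoints:
  "(\<Sum>u\<in>UNIV. \<Sum>v\<in>UNIV. w u v * (g u + g v)) = 2 * (\<Sum>u\<in>UNIV. d u * g u)"
proof -
  have "(\<Sum>u\<in>UNIV. \<Sum>v\<in>UNIV. w u v * g v) = (\<Sum>v\<in>UNIV. \<Sum>u\<in>UNIV. w u v * g v)"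
    by (rule sum.swap)
  also have "\<dots> = (\<Sum>v\<in>UNIV. d v * g v)"
    by (intro sum.cong refl) (simp add: d_eq sum_distrib_right w_sym)
  finally show ?thesis
    by (simp add: distrib_left sum.distrib d_eq sum_distrib_right)
qed

lemma s_square [simp]: "(s u v)\<^sup>2 = 1"
  using s_sign[of u v] by auto

lemma energy_eq:
  "energy f = mass f - (\<Sum>u\<in>UNIV. \<Sum>v\<in>UNIV. w u v * s u v * f u * f v)"
proof -
  have "(\<Sum>u\<in>UNIV. \<Sum>v\<in>UNIV. w u v * (f u - s u v * f v)\<^sup>2)
      = (\<Sum>u\<in>UNIV. \<Sum>v\<in>UNIV. w u v * ((f u)\<^sup>2 + (f v)\<^sup>2) - 2 * (w u v * s u v * f u * f v))"
    by (intro sum.cong refl) (simp add: power2_diff power_mult_distrib algebra_simps)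
  also have "\<dots> = 2 * mass f - 2 * (\<Sum>u\<in>UNIV. \<Sum>v\<in>UNIV. w u v * s u v * f u * f v)"
    by (simp add: sum_subtractf sum_weights_endpoints sum_distrib_left mass_def)
  finally show ?thesis by (simp add: energy_def)
qed

text \<open>Bounds the eigenvalues by 2.\<close>

lemma energy_le_two_mass: "energy f \<le> 2 * mass f"
proof -
  have "energy f \<le> (\<Sum>u\<in>UNIV. \<Sum>v\<in>UNIV. w u v * (2 * (f u)\<^sup>2 + 2 * (f v)\<^sup>2)) / 2"
    unfolding energy_def
  proof (intro divide_right_mono sum_mono mult_left_mono)
    fix u v
    have "0 \<le> (f u + s u v * f v)\<^sup>2" by simp
    then show "(f u - s u v * f v)\<^sup>2 \<le> 2 * (f u)\<^sup>2 + 2 * (f v)\<^sup>2"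
      by (simp add: power2_diff power2_sum power_mult_distrib)
  qed (auto simp: w_nonneg)
  also have "\<dots> = 2 * mass f"
    using sum_weights_endpoints[of "\<lambda>u. 2 * (f u)\<^sup>2"] by (simp add: mass_def sum_distrib_left algebra_simps)
  finally show ?thesis .
qed

text \<open>Coarea inequality: the sign pattern of \<open>g\<close> is peeled off with the smallest nonzero value
  of \<open>\<bar>g\<bar>\<close> as its coefficient; this exhausts \<open>g\<close> because the support shrinks.\<close>

lemma variation_ge_of_sign_functions:
  assumes sgn: "\<And>\<psi>. (\<And>u. \<psi> u \<in> {-1, 0, 1}) \<Longrightarrow> h * (\<Sum>u\<in>UNIV. d u * \<bar>\<psi> u\<bar>) \<le> variation \<psi>"
  shows "h * (\<Sum>u\<in>UNIV. d u * \<bar>g u\<bar>) \<le> variation g"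
proof (induction "card {u. g u \<noteq> 0}" arbitrary: g rule: less_induct)
  case less
  show ?case
  proof (cases "\<forall>u. g u = 0")
    case True
    then show ?thesis using variation_nonneg by simp
  next
    case False
    define m where "m = Min ((\<lambda>u. \<bar>g u\<bar>) ` {u. g u \<noteq> 0})"
    define \<psi> where "\<psi> u = sgn (g u)" for u
    define g' where "g' u = g u - m * \<psi> u" for u
    have "m \<in> (\<lambda>u. \<bar>g u\<bar>) ` {u. g u \<noteq> 0}"
      unfolding m_def using False by (intro Min_in) auto
    then obtain u0 where u0: "g u0 \<noteq> 0" "m = \<bar>g u0\<bar>" by auto
    have mle: "m \<le> \<bar>g u\<bar>" if "g u \<noteq> 0" for u
      unfolding m_def using that by (intro Min_le) auto
    have m: "0 \<le> m" using u0 by simp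
    have "g' u0 = 0" using u0 by (simp add: g'_def \<psi>_def abs_mult_sgn)
    then have "u0 \<notin> {u. g' u \<noteq> 0}" "u0 \<in> {u. g u \<noteq> 0}" using u0 by simp_all
    moreover have "{u. g' u \<noteq> 0} \<subseteq> {u. g u \<noteq> 0}" by (auto simp: g'_def \<psi>_def)
    ultimately have "{u. g' u \<noteq> 0} \<subset> {u. g u \<noteq> 0}" by blast
    then have "card {u. g' u \<noteq> 0} < card {u. g u \<noteq> 0}" by (intro psubset_card_mono) auto
    then have IH: "h * (\<Sum>u\<in>UNIV. d u * \<bar>g' u\<bar>) \<le> variation g'" by (rule less)
    have "\<bar>g u\<bar> = \<bar>g' u\<bar> + m * \<bar>\<psi> u\<bar>" for u
      using abs_diff_truncate[of m "g u" 0] m mle[of u] by (auto simp: g'_def \<psi>_def)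
    then have "h * (\<Sum>u\<in>UNIV. d u * \<bar>g u\<bar>)
        = h * (\<Sum>u\<in>UNIV. d u * \<bar>g' u\<bar>) + m * (h * (\<Sum>u\<in>UNIV. d u * \<bar>\<psi> u\<bar>))"
      by (simp add: distrib_left sum.distrib sum_distrib_left mult_ac)
    also have "\<dots> \<le> variation g' + m * variation \<psi>"
      by (intro add_mono IH mult_left_mono sgn m) (simp add: \<psi>_def sgn_if)
    also have "\<dots> = variation g"
    proof -
      have "\<bar>g u - s u v * g v\<bar> = \<bar>g' u - s u v * g' v\<bar> + m * \<bar>\<psi> u - s u v * \<psi> v\<bar>" for u v
        using abs_diff_truncate[of m "g u" "s u v * g v"] m mle[of u] mle[of v] s_sign[of u v]
        by (auto simp: g'_def \<psi>_def sgn_mult algebra_simps sgn_minus)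
      then show ?thesis
        by (simp add: variation_def distrib_left sum.distrib add_divide_distrib sum_distrib_left mult_ac)
    qed
    finally show ?thesis .
  qed
qed

section \<open>Families of functions with disjoint supports\<close>

text \<open>Along one edge at most two members differ, so Cauchy-Schwarz on two terms costs the
  factor 2; this is the loss in passing from disjoint test functions to their span.\<close>

lemma energy_disjoint_combination_le:
  assumes "finite I" and disj: "\<And>i j u. F i u \<noteq> 0 \<Longrightarrow> F j u \<noteq> 0 \<Longrightarrow> i = j"
  shows "energy (\<lambda>u. \<Sum>i\<in>I. a i * F i u) \<le> 2 * (\<Sum>i\<in>I. (a i)\<^sup>2 * energy (F i))"
proof -
  have "(\<Sum>u\<in>UNIV. \<Sum>v\<in>UNIV. w u v * ((\<Sum>i\<in>I. a i * F i u) - s u v * (\<Sum>i\<in>I. a i * F i v))\<^sup>2)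
      \<le> (\<Sum>u\<in>UNIV. \<Sum>v\<in>UNIV. w u v * (2 * (\<Sum>i\<in>I. (a i * F i u - s u v * (a i * F i v))\<^sup>2)))"
  proof (intro sum_mono mult_left_mono w_nonneg)
    fix u v
    have "card {i \<in> I. a i * F i u - s u v * (a i * F i v) \<noteq> 0} \<le> 2"
      by (rule card_nonzero_diff_le_two) (use disj assms(1) in auto)
    then have "(\<Sum>i\<in>I. a i * F i u - s u v * (a i * F i v))\<^sup>2
        \<le> 2 * (\<Sum>i\<in>I. (a i * F i u - s u v * (a i * F i v))\<^sup>2)"
      using assms(1) by (intro square_sum_le_two_sum_squares)
    then show "((\<Sum>i\<in>I. a i * F i u) - s u v * (\<Sum>i\<in>I. a i * F i v))\<^sup>2
        \<le> 2 * (\<Sum>i\<in>I. (a i * F i u - s u v * (a i * F i v))\<^sup>2)"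
      by (simp add: sum_subtractf sum_distrib_left)
  qed
  also have "\<dots> = (\<Sum>u\<in>UNIV. \<Sum>v\<in>UNIV. \<Sum>i\<in>I. 2 * (a i)\<^sup>2 * (w u v * (F i u - s u v * F i v)\<^sup>2))"
  proof (intro sum.cong refl)
    fix u v
    have "(a i * F i u - s u v * (a i * F i v))\<^sup>2 = (a i)\<^sup>2 * (F i u - s u v * F i v)\<^sup>2" for i
      by (simp add: power2_eq_square algebra_simps)
    then show "w u v * (2 * (\<Sum>i\<in>I. (a i * F i u - s u v * (a i * F i v))\<^sup>2))
        = (\<Sum>i\<in>I. 2 * (a i)\<^sup>2 * (w u v * (F i u - s u v * F i v)\<^sup>2))"
      by (simp add: sum_distrib_left mult_ac)
  qed
  also have "\<dots> = (\<Sum>u\<in>UNIV. \<Sum>i\<in>I. \<Sum>v\<in>UNIV. 2 * (a i)\<^sup>2 * (w u v * (F i u - s u v * F i v)\<^sup>2))"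
    by (intro sum.cong refl sum.swap)
  also have "\<dots> = (\<Sum>i\<in>I. \<Sum>u\<in>UNIV. \<Sum>v\<in>UNIV. 2 * (a i)\<^sup>2 * (w u v * (F i u - s u v * F i v)\<^sup>2))"
    by (rule sum.swap)
  also have "\<dots> = 4 * (\<Sum>i\<in>I. (a i)\<^sup>2 * energy (F i))"
    by (simp add: energy_def sum_distrib_left sum_divide_distrib mult_ac)
  finally show ?thesis by (simp add: energy_def)
qed

lemma mass_disjoint_combination:
  assumes "finite I" and disj: "\<And>i j u. F i u \<noteq> 0 \<Longrightarrow> F j u \<noteq> 0 \<Longrightarrow> i = j"
  shows "mass (\<lambda>u. \<Sum>i\<in>I. a i * F i u) = (\<Sum>i\<in>I. (a i)\<^sup>2 * mass (F i))"
proof -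
  have "(\<Sum>i\<in>I. a i * F i u)\<^sup>2 = (\<Sum>i\<in>I. (a i)\<^sup>2 * (F i u)\<^sup>2)" for u
  proof (cases "\<exists>j\<in>I. F j u \<noteq> 0")
    case True
    then obtain j where j: "j \<in> I" "F j u \<noteq> 0" by blast
    then have "F i u = 0" if "i \<noteq> j" for i using disj that by blast
    then have "(\<Sum>i\<in>I. a i * F i u) = a j * F j u" "(\<Sum>i\<in>I. (a i)\<^sup>2 * (F i u)\<^sup>2) = (a j)\<^sup>2 * (F j u)\<^sup>2"
      using assms(1) j by (auto simp: sum.remove[of I j] intro!: sum.neutral)
    then show ?thesis by (simp add: power_mult_distrib)
  qed simp
  then have "mass (\<lambda>u. \<Sum>i\<in>I. a i * F i u) = (\<Sum>u\<in>UNIV. \<Sum>i\<in>I. (a i)\<^sup>2 * (d u * (F i u)\<^sup>2))"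
    by (simp add: mass_def sum_distrib_left mult_ac)
  also have "\<dots> = (\<Sum>i\<in>I. \<Sum>u\<in>UNIV. (a i)\<^sup>2 * (d u * (F i u)\<^sup>2))" by (rule sum.swap)
  finally show ?thesis by (simp add: mass_def sum_distrib_left)
qed

text \<open>Tents are odd and 1-Lipschitz, so on an edge each piece varies at most as much as
  \<open>f\<close>, and at most two pieces vary.\<close>

lemma sum_tent_energy_le:
  assumes "incseq t" "0 \<le> t 0"
  shows "(\<Sum>i<n. energy (\<lambda>u. tent (t i) (t (Suc i)) (f u))) \<le> 2 * energy f"
proof -
  let ?T = "\<lambda>i. tent (t i) (t (Suc i))"
  have t: "0 \<le> t i" for i using assms incseqD[OF assms(1), of 0 i] by simp
  have "(\<Sum>i<n. \<Sum>u\<in>UNIV. \<Sum>v\<in>UNIV. w u v * (?T i (f u) - s u v * ?T i (f v))\<^sup>2)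
      = (\<Sum>u\<in>UNIV. \<Sum>i<n. \<Sum>v\<in>UNIV. w u v * (?T i (f u) - s u v * ?T i (f v))\<^sup>2)"
    by (rule sum.swap)
  also have "\<dots> = (\<Sum>u\<in>UNIV. \<Sum>v\<in>UNIV. \<Sum>i<n. w u v * (?T i (f u) - s u v * ?T i (f v))\<^sup>2)"
    by (intro sum.cong refl sum.swap)
  also have "\<dots> = (\<Sum>u\<in>UNIV. \<Sum>v\<in>UNIV. w u v * (\<Sum>i<n. (?T i (f u) - s u v * ?T i (f v))\<^sup>2))"
    by (simp add: sum_distrib_left)
  also have "\<dots> \<le> (\<Sum>u\<in>UNIV. \<Sum>v\<in>UNIV. w u v * (2 * (f u - s u v * f v)\<^sup>2))"
  proof (intro sum_mono mult_left_mono w_nonneg sum_squares_le_two_bound)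
    fix u v
    show "card {i \<in> {..<n}. ?T i (f u) - s u v * ?T i (f v) \<noteq> 0} \<le> 2"
      using tent_index_unique[OF assms(1)] by (intro card_nonzero_diff_le_two) auto
    show "\<bar>?T i (f u) - s u v * ?T i (f v)\<bar> \<le> \<bar>f u - s u v * f v\<bar>" for i
      using tent_lipschitz[OF t] tent_mult_sign[OF s_sign] by metis
  qed auto
  also have "\<dots> = 4 * energy f" by (simp add: energy_def sum_distrib_left mult_ac)
  finally show ?thesis
    by (simp add: energy_def flip: sum_divide_distrib)
qed

section \<open>Thresholds and approximation by a function with few values\<close>

text \<open>Greedy choice: the next threshold is \<open>M\<close> if the mass up to \<open>M\<close>
  is at most \<open>C\<close>, and otherwise, by the intermediate value theorem, a point where the
  mass is exactly \<open>C\<close>. Once \<open>M\<close> is reached the last threshold is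
  repeated.\<close>

lemma thresholds_exist:
  assumes "0 < C" "0 \<le> M"
  shows "\<exists>t. incseq t \<and> t 0 = 0 \<and> (\<forall>i<n. mass (\<lambda>u. tent (t i) (t (Suc i)) (f u)) \<le> C)
    \<and> (M \<le> t n \<or> (\<forall>i<n. mass (\<lambda>u. tent (t i) (t (Suc i)) (f u)) = C))"
proof (induction n)
  case 0
  then show ?case by (intro exI[of _ "\<lambda>_. 0"]) (auto simp: incseq_def)
next
  case (Suc n)
  define c where "c a b = mass (\<lambda>u. tent a b (f u))" for a b
  from Suc obtain t where t: "incseq t" "t 0 = 0" "\<And>i. i < n \<Longrightarrow> c (t i) (t (Suc i)) \<le> C"
    "M \<le> t n \<or> (\<forall>i<n. c (t i) (t (Suc i)) = C)" by (auto simp: c_def)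
  have c0: "c a a = 0" for a by (simp add: c_def mass_def)
  \<comment> \<open>The conjunct \<open>\<not> M \<le> t n\<close> rules out the first alternative
    at stage \<open>n\<close>, so a new gap of mass \<open>C\<close> comes with earlier gaps that
    all have mass \<open>C\<close>.\<close>
  have "\<exists>b\<ge>t n. c (t n) b \<le> C \<and> (M \<le> b \<or> (\<not> M \<le> t n \<and> c (t n) b = C))"
  proof (cases "M \<le> t n")
    case True
    then show ?thesis using c0 assms(1) by (intro exI[of _ "t n"]) auto
  next
    case M: False
    show ?thesis
    proof (cases "c (t n) M \<le> C")
      case True
      then show ?thesis using M by (intro exI[of _ M]) auto
    next
      case False
      have "continuous_on {t n..M} (c (t n))"
        unfolding c_def mass_def tent_def by (intro continuous_intros)
      then obtain b where "t n \<le> b" "b \<le> M" "c (t n) b = C"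
        using IVT'[of "c (t n)" "t n" C M] c0 assms(1) False M by auto
      then show ?thesis using M by (intro exI[of _ b]) auto
    qed
  qed
  then obtain b where b: "t n \<le> b" "c (t n) b \<le> C" "M \<le> b \<or> (\<not> M \<le> t n \<and> c (t n) b = C)" by blast
  define t' where "t' i = (if i \<le> n then t i else b)" for i
  have "incseq t'"
    using t(1) b(1) by (auto simp: t'_def incseq_def intro: order_trans)
  moreover have "t' 0 = 0" using t(2) by (simp add: t'_def)
  moreover have "\<forall>i<Suc n. c (t' i) (t' (Suc i)) \<le> C"
    using t(3) b(2) by (auto simp: t'_def less_Suc_eq)
  moreover have "M \<le> t' (Suc n) \<or> (\<forall>i<Suc n. c (t' i) (t' (Suc i)) = C)"
    using t(4) b(3) by (auto simp: t'_def less_Suc_eq)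
  ultimately show ?case unfolding c_def by blast
qed

text \<open>\<open>r\<close> is a free weight in the AM-GM step that separates the energy from the
  distance of \<open>f\<close> to the thresholds; it is fixed in
  \<open>improved_cheeger_bound\<close>.\<close>

lemma step_approximation_bound:
  fixes t :: "nat \<Rightarrow> real"
  assumes cut: "\<And>g. h * (\<Sum>u\<in>UNIV. d u * \<bar>g u\<bar>) \<le> variation g" and "0 \<le> h"
    and t: "incseq t" "t 0 = 0" "\<And>u. \<bar>f u\<bar> \<le> t n" and "0 < n" "0 < r"
  shows "h * mass f \<le> 4 * n * (energy f / 2 + r * energy f / 4
    + (\<Sum>i<n. mass (\<lambda>u. tent (t i) (t (Suc i)) (f u))) / (2 * r))"
proof -
  \<comment> \<open>The function \<open>F\<close> below is the odd antiderivative of the distance to the thresholds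
    \<open>t 0, \<dots>, t n\<close> and their negatives; the coarea inequality is applied to \<open>F \<circ> f\<close>.\<close>
  define T where "T = t ` {..n} \<union> uminus ` t ` {..n}"
  define \<eta> where "\<eta> x = infdist x T" for x
  have tnn: "0 \<le> t i" for i using t(2) incseqD[OF t(1), of 0 i] by simp
  have T: "t i \<in> T" if "i \<le> n" for i using that by (auto simp: T_def)
  have Tne: "T \<noteq> {}" by (auto simp: T_def)
  have \<eta>0: "0 \<le> \<eta> x" for x by (simp add: \<eta>_def infdist_nonneg)
  have \<eta>_lip: "\<eta> x \<le> \<eta> y + \<bar>x - y\<bar>" for x y
    using infdist_triangle[of x T y] by (simp add: \<eta>_def dist_real_def)
  have \<eta>_even: "\<eta> (- x) = \<eta> x" for x
  proof -
    have "\<eta> (- x) \<le> \<eta> x" for x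
      unfolding \<eta>_def
    proof (subst (2) infdist_notempty[OF Tne], rule cINF_greatest[OF Tne])
      fix y assume "y \<in> T"
      then have "- y \<in> T" by (auto simp: T_def)
      then have "infdist (- x) T \<le> dist (- x) (- y)" by (rule infdist_le)
      then show "infdist (- x) T \<le> dist x y" by (simp add: dist_real_def abs_minus_commute)
    qed
    from this[of x] this[of "- x"] show ?thesis by simp
  qed
  have \<eta>_ge: "min (y - t i) (t (Suc i) - y) \<le> \<eta> y" if "t i \<le> y" "y \<le> t (Suc i)" for i y
    unfolding \<eta>_def
  proof (subst infdist_notempty[OF Tne], rule cINF_greatest[OF Tne])
    fix z assume "z \<in> T"
    then obtain j where j: "z = t j \<or> z = - t j" by (auto simp: T_def)
    \<comment> \<open>No threshold lies strictly inside the gap and every \<open>- t j\<close> lies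
      at or below \<open>t i\<close>, so no point of \<open>T\<close> is nearer to \<open>y\<close>
      than both ends of the gap.\<close>
    have "t j \<le> t i \<or> t (Suc i) \<le> t j"
      using incseqD[OF t(1), of j i] incseqD[OF t(1), of "Suc i" j] by linarith
    then show "min (y - t i) (t (Suc i) - y) \<le> dist y z"
      using j that tnn[of j] tnn[of i] by (auto simp: dist_real_def)
  qed
  have "isCont \<eta> x" for x unfolding \<eta>_def by (intro continuous_intros)
  then obtain F where F: "\<And>x. (F has_real_derivative \<eta> x) (at x)" and odd: "\<And>x. F (- x) = - F x"
    using continuous_odd_antiderivative[of \<eta>] \<eta>_even by blast
  have F0: "F 0 = 0" using odd[of 0] by simp
  have F_ge: "(f u)\<^sup>2 / (4 * n) \<le> \<bar>F (f u)\<bar>" for u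
  proof -
    have "\<bar>f u\<bar>\<^sup>2 / (4 * real n) \<le> F \<bar>f u\<bar>"
      using t(3) by (intro threshold_distance_antiderivative_ge[OF F F0 t(1,2) \<eta>_ge]) auto
    also have "F \<bar>f u\<bar> \<le> \<bar>F (f u)\<bar>" using odd[of "f u"] by (auto simp: abs_if)
    finally show ?thesis by simp
  qed
  have \<eta>_le: "(\<Sum>u\<in>UNIV. d u * (\<eta> (f u))\<^sup>2) \<le> (\<Sum>i<n. mass (\<lambda>u. tent (t i) (t (Suc i)) (f u)))"
  proof -
    have "(\<eta> (f u))\<^sup>2 \<le> (\<Sum>i<n. (tent (t i) (t (Suc i)) (f u))\<^sup>2)" for u
    proof -
      obtain i where i: "i < n" "t i \<le> \<bar>f u\<bar>" "\<bar>f u\<bar> \<le> t (Suc i)"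
        using incseq_bracket[of t "\<bar>f u\<bar>" n] t(2,3) \<open>0 < n\<close> by auto
      have "\<eta> (f u) = \<eta> \<bar>f u\<bar>" using \<eta>_even[of "f u"] by (auto simp: abs_if)
      also have "\<dots> \<le> min (\<bar>f u\<bar> - t i) (t (Suc i) - \<bar>f u\<bar>)"
        using infdist_le[OF T[of i], of "\<bar>f u\<bar>"] infdist_le[OF T[of "Suc i"], of "\<bar>f u\<bar>"] i
        by (simp add: \<eta>_def dist_real_def)
      finally have le: "\<eta> (f u) \<le> min (\<bar>f u\<bar> - t i) (t (Suc i) - \<bar>f u\<bar>)" .
      have "\<eta> (f u) \<le> \<bar>tent (t i) (t (Suc i)) (f u)\<bar>"
      \<comment> \<open>At 0 the factor \<open>sgn\<close> makes the tent vanish; there the distance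
        vanishes too, because \<open>t 0 = 0\<close> is a threshold.\<close>
      proof (cases "f u = 0")
        case True
        have "\<eta> 0 \<le> 0" using infdist_le[OF T[of 0], of 0] t(2) by (simp add: \<eta>_def)
        then show ?thesis using True by simp
      next
        case False
        then show ?thesis using le i by (simp add: tent_eq_sgn abs_mult)
      qed
      then have "(\<eta> (f u))\<^sup>2 \<le> (tent (t i) (t (Suc i)) (f u))\<^sup>2"
        using \<eta>0 by (simp flip: abs_le_square_iff)
      also have "\<dots> \<le> (\<Sum>i<n. (tent (t i) (t (Suc i)) (f u))\<^sup>2)"
        using i(1) by (intro member_le_sum) auto
      finally show ?thesis .
    qed
    then have "(\<Sum>u\<in>UNIV. d u * (\<eta> (f u))\<^sup>2) \<le> (\<Sum>u\<in>UNIV. d u * (\<Sum>i<n. (tent (t i) (t (Suc i)) (f u))\<^sup>2))"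
      by (intro sum_mono mult_left_mono) (auto simp: d_pos less_imp_le)
    also have "\<dots> = (\<Sum>i<n. mass (\<lambda>u. tent (t i) (t (Suc i)) (f u)))"
      unfolding mass_def by (subst sum.swap) (simp add: sum_distrib_left)
    finally show ?thesis .
  qed
  have "\<bar>F (f u) - s u v * F (f v)\<bar>
      \<le> (1 / 2 + r / 4) * (f u - s u v * f v)\<^sup>2 + ((\<eta> (f u))\<^sup>2 + (\<eta> (f v))\<^sup>2) / (2 * r)" for u v
  proof -
    define x where "x = \<bar>f u - s u v * f v\<bar>"
    have sF: "s u v * F (f v) = F (s u v * f v)" and s\<eta>: "\<eta> (s u v * f v) = \<eta> (f v)"
      using s_sign[of u v] odd \<eta>_even by auto
    have "\<bar>F (f u) - s u v * F (f v)\<bar> \<le> x * (\<eta> (f u) + \<eta> (f v) + x) / 2"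
      using antiderivative_lipschitz_diff_bound[OF F \<eta>_lip \<eta>0, of "f u" "s u v * f v"]
      by (simp add: sF s\<eta> x_def)
    also have "\<dots> \<le> x\<^sup>2 / 2 + r * x\<^sup>2 / 4 + ((\<eta> (f u))\<^sup>2 + (\<eta> (f v))\<^sup>2) / (2 * r)"
    proof -
      \<comment> \<open>Divided by \<open>8 * r\<close>, the expanded squares are exactly the AM-GM
        bound needed for the mixed terms.\<close>
      have "0 \<le> (r * x - 2 * \<eta> (f u))\<^sup>2 + (r * x - 2 * \<eta> (f v))\<^sup>2" by simp
      then have "x * (\<eta> (f u) + \<eta> (f v)) / 2 \<le> r * x\<^sup>2 / 4 + ((\<eta> (f u))\<^sup>2 + (\<eta> (f v))\<^sup>2) / (2 * r)"
        using \<open>0 < r\<close> by (simp add: field_simps power2_eq_square)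
      then show ?thesis by (simp add: field_simps power2_eq_square)
    qed
    finally show ?thesis by (simp add: x_def algebra_simps)
  qed
  then have "variation (\<lambda>u. F (f u)) \<le> (\<Sum>u\<in>UNIV. \<Sum>v\<in>UNIV. w u v *
      ((1 / 2 + r / 4) * (f u - s u v * f v)\<^sup>2 + ((\<eta> (f u))\<^sup>2 + (\<eta> (f v))\<^sup>2) / (2 * r))) / 2"
    unfolding variation_def by (intro divide_right_mono sum_mono mult_left_mono w_nonneg) auto
  also have "\<dots> = (1 / 2 + r / 4) * energy f
      + (\<Sum>u\<in>UNIV. \<Sum>v\<in>UNIV. w u v * ((\<eta> (f u))\<^sup>2 / (2 * r) + (\<eta> (f v))\<^sup>2 / (2 * r))) / 2"
    by (simp only: energy_def distrib_left sum.distrib add_divide_distrib sum_distrib_left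
        times_divide_eq_right mult.left_commute)
  also have "\<dots> = (1 / 2 + r / 4) * energy f + (\<Sum>u\<in>UNIV. d u * (\<eta> (f u))\<^sup>2) / (2 * r)"
    by (simp add: sum_weights_endpoints sum_divide_distrib)
  also have "\<dots> \<le> (1 / 2 + r / 4) * energy f
      + (\<Sum>i<n. mass (\<lambda>u. tent (t i) (t (Suc i)) (f u))) / (2 * r)"
    using \<eta>_le \<open>0 < r\<close> by (intro add_left_mono divide_right_mono) auto
  finally have V: "variation (\<lambda>u. F (f u)) \<le> energy f / 2 + r * energy f / 4
    + (\<Sum>i<n. mass (\<lambda>u. tent (t i) (t (Suc i)) (f u))) / (2 * r)" (is "_ \<le> ?R")
    by (simp add: algebra_simps)
  have "h * mass f / (4 * n) = h * (\<Sum>u\<in>UNIV. d u * ((f u)\<^sup>2 / (4 * n)))"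
    by (simp add: mass_def flip: sum_divide_distrib)
  also have "\<dots> \<le> h * (\<Sum>u\<in>UNIV. d u * \<bar>F (f u)\<bar>)"
    using \<open>0 \<le> h\<close> by (intro mult_left_mono sum_mono F_ge) (auto simp: d_pos less_imp_le)
  also have "\<dots> \<le> ?R" using cut V by (rule order_trans)
  finally have "h * mass f \<le> ?R * (4 * n)" using \<open>0 < n\<close> by (simp add: pos_divide_le_eq)
  then show ?thesis by (simp only: mult.commute mult.left_commute)
qed

text \<open>\<open>h\<close> will be the Cheeger constant, \<open>l\<close> the k-th eigenvalue and
  \<open>energy f\<close> the first one. The spectrum enters only through the bounds on
  \<open>l\<close>, the energy of \<open>f\<close> and \<open>minmax\<close>.\<close>

lemma improved_cheeger_bound:
  fixes l h :: real and f :: "'v \<Rightarrow> real" and k :: nat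
  assumes cut: "\<And>g. h * (\<Sum>u\<in>UNIV. d u * \<bar>g u\<bar>) \<le> variation g" and "0 \<le> h"
    and f: "mass f = 1" "0 < energy f" and "0 < k" and l: "0 < l" "l \<le> 2"
    and minmax: "\<And>(F :: nat \<Rightarrow> 'v \<Rightarrow> real) I c. finite I \<Longrightarrow> card I = k
        \<Longrightarrow> (\<And>i j u. F i u \<noteq> 0 \<Longrightarrow> F j u \<noteq> 0 \<Longrightarrow> i = j)
        \<Longrightarrow> (\<And>i. i \<in> I \<Longrightarrow> 0 < mass (F i) \<and> energy (F i) \<le> c * mass (F i)) \<Longrightarrow> l \<le> 2 * c"
  shows "h < 16 * sqrt 2 * k * (energy f / sqrt l)"
proof -
  define E where "E = energy f"
  have E: "0 < E" using f(2) by (simp add: E_def)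
  \<comment> \<open>Any factor between \<open>4\<close> and roughly \<open>4.4\<close> would do for \<open>41 / 10\<close>: above \<open>4\<close> the min-max principle
    forces the thresholds to reach \<open>max \<bar>f\<bar>\<close>, and the upper limit keeps the final factor below
    \<open>16 * sqrt 2\<close>.\<close>
  define C where "C = 41 / 10 * E / (k * l)"
  have C: "0 < C" using E \<open>0 < k\<close> l by (simp add: C_def)
  define M where "M = Max (range (\<lambda>u. \<bar>f u\<bar>))"
  have M: "\<bar>f u\<bar> \<le> M" for u by (simp add: M_def)
  have M0: "0 \<le> M" using M[of undefined] by linarith
  obtain t where t: "incseq t" "t 0 = 0" and
    tC: "\<And>i. i < 2 * k \<Longrightarrow> mass (\<lambda>u. tent (t i) (t (Suc i)) (f u)) \<le> C" and
    alt: "M \<le> t (2 * k) \<or> (\<forall>i<2 * k. mass (\<lambda>u. tent (t i) (t (Suc i)) (f u)) = C)"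
    using thresholds_exist[OF C M0, of "2 * k" f] by auto
  let ?F = "\<lambda>i u. tent (t i) (t (Suc i)) (f u)"
  have "M \<le> t (2 * k)"
  proof (rule ccontr)
    assume "\<not> M \<le> t (2 * k)"
    then have eq: "mass (?F i) = C" if "i < 2 * k" for i using alt that by blast
    have "(\<Sum>i<2 * k. energy (?F i)) \<le> 2 * E"
      using sum_tent_energy_le[OF t(1)] t(2) by (simp add: E_def)
    then obtain I where I: "I \<subseteq> {..<2 * k}" "card I = k" "\<And>i. i \<in> I \<Longrightarrow> energy (?F i) \<le> 2 * E / k"
      using many_small_terms[of k "\<lambda>i. energy (?F i)" "2 * E"] energy_nonneg \<open>0 < k\<close> by metis
    \<comment> \<open>The \<open>k\<close> chosen pieces have mass \<open>C\<close> and energy at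
      most \<open>2 * E / k\<close>; by the choice of \<open>C\<close> the resulting bound is
      strictly below \<open>l\<close>.\<close>
    have "l \<le> 2 * (2 * E / k / C)"
    proof (rule minmax[of I ?F])
      show "finite I" using I(1) finite_subset by blast
      show "i = j" if "?F i u \<noteq> 0" "?F j u \<noteq> 0" for i j u
        using tent_index_unique[OF t(1) that] .
      show "0 < mass (?F i) \<and> energy (?F i) \<le> 2 * E / k / C * mass (?F i)" if "i \<in> I" for i
        using that I eq[of i] C by auto
    qed (rule I(2))
    also have "\<dots> = 40 / 41 * l" using E \<open>0 < k\<close> l by (simp add: C_def field_simps)
    finally show False using l by simp
  qed
  then have ft: "\<bar>f u\<bar> \<le> t (2 * k)" for u using M order_trans by blast
  define q where "q = sqrt l"
  have q: "0 < q" "q * q = l" using l by (simp_all add: q_def)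
  \<comment> \<open>A decimal upper bound for sqrt 2; it turns the term \<open>E / 2\<close> into a
    multiple of \<open>E / q\<close>.\<close>
  have "q \<le> 1.4143"
  proof -
    have "q \<le> sqrt 2" using l by (simp add: q_def)
    also have "\<dots> \<le> 1.4143" by (rule real_le_lsqrt) (simp_all add: power2_eq_square)
    finally show ?thesis .
  qed
  have "(\<Sum>i<2 * k. mass (?F i)) \<le> (\<Sum>i<2 * k. C)" using tC by (intro sum_mono) auto
  also have "\<dots> = 8.2 * E / l" using \<open>0 < k\<close> by (simp add: C_def field_simps)
  finally have S: "(\<Sum>i<2 * k. mass (?F i)) \<le> 8.2 * E / l" .
  \<comment> \<open>The choice \<open>r = 4 / q\<close> nearly balances the two terms containing
    \<open>r\<close>: they become \<open>E / q\<close> and at most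
    \<open>1.025 * (E / q)\<close>.\<close>
  have "h \<le> 4 * real (2 * k) * (E / 2 + (4 / q) * E / 4 + (\<Sum>i<2 * k. mass (?F i)) / (2 * (4 / q)))"
    using step_approximation_bound[where f = f, OF cut \<open>0 \<le> h\<close> t ft, of "4 / q"] q \<open>0 < k\<close> f(1)
    by (simp add: E_def)
  also have "\<dots> \<le> 8 * k * (E / 2 + E / q + 8.2 * E / l / (2 * (4 / q)))"
  proof -
    have "(\<Sum>i<2 * k. mass (?F i)) / (2 * (4 / q)) \<le> 8.2 * E / l / (2 * (4 / q))"
      using S q by (intro divide_right_mono) auto
    then show ?thesis using \<open>0 < k\<close> by simp
  qed
  also have "8.2 * E / l / (2 * (4 / q)) = 1.025 * (E / q)"
    using q by (simp add: field_simps flip: q(2))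
  also have "E / 2 \<le> 0.70715 * (E / q)"
    using E q \<open>q \<le> 1.4143\<close> by (simp add: field_simps)
  finally have "h \<le> 8 * k * (0.70715 * (E / q) + E / q + 1.025 * (E / q))" using \<open>0 < k\<close> by simp
  also have "\<dots> = 21.8572 * (k * (E / q))" by (simp add: algebra_simps)
  also have "\<dots> < 16 * sqrt 2 * (k * (E / q))"
  proof (rule mult_strict_right_mono)
    have "1.4 < sqrt 2" by (rule real_less_rsqrt) (simp add: power2_eq_square)
    then show "21.8572 < 16 * sqrt 2" by simp
  qed (use E q \<open>0 < k\<close> in simp)
  finally show ?thesis by (simp add: E_def q_def mult.assoc)
qed

section \<open>The symmetric normalized Laplacian\<close>

text \<open>With L the signed Laplacian this is D^(1/2) L D^(-1/2): symmetric, so the spectral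
  theory applies, and similar to L.\<close>

definition normalized_laplacian :: "real ^ 'v ^ 'v" where
  "normalized_laplacian = (\<chi> u v. (if u = v then 1 else 0) - w u v * s u v / (sqrt (d u) * sqrt (d v)))"

lemma transpose_normalized_laplacian: "transpose normalized_laplacian = normalized_laplacian"
  by (auto simp: normalized_laplacian_def transpose_def vec_eq_iff w_sym s_sym mult.commute)

text \<open>D^(1/2) f, which carries the degree-weighted inner product to the Euclidean one.\<close>

definition scaled :: "('v \<Rightarrow> real) \<Rightarrow> real ^ 'v" where
  "scaled f = (\<chi> u. sqrt (d u) * f u)"

lemma d_nonzero [simp]: "d u \<noteq> 0" and abs_d [simp]: "\<bar>d u\<bar> = d u"
  using d_pos[of u] by simp_all

lemma scaled_surj: "\<exists>f. x = scaled f"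
  by (intro exI[of _ "\<lambda>u. x $ u / sqrt (d u)"]) (simp add: scaled_def vec_eq_iff)

lemma inner_scaled: "scaled f \<bullet> scaled g = (\<Sum>u\<in>UNIV. d u * (f u * g u))"
  by (simp add: scaled_def inner_vec_def algebra_simps)

lemma inner_scaled_self: "scaled f \<bullet> scaled f = mass f"
  by (simp add: inner_scaled mass_def power2_eq_square)

lemma inner_normalized_laplacian: "scaled f \<bullet> (normalized_laplacian *v scaled f) = energy f"
proof -
  have "(normalized_laplacian *v scaled f) $ u
      = sqrt (d u) * f u - (\<Sum>v\<in>UNIV. w u v * s u v * f v) / sqrt (d u)" for u
  proof -
    have "(normalized_laplacian *v scaled f) $ u
      = (\<Sum>v\<in>UNIV. (if u = v then sqrt (d v) * f v else 0) - w u v * s u v * f v / sqrt (d u))"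
      by (auto simp: normalized_laplacian_def matrix_vector_mult_def scaled_def field_simps intro!: sum.cong)
    then show ?thesis by (simp add: sum_subtractf sum_divide_distrib)
  qed
  then have "scaled f \<bullet> (normalized_laplacian *v scaled f)
      = (\<Sum>u\<in>UNIV. d u * (f u)\<^sup>2 - (\<Sum>v\<in>UNIV. w u v * s u v * f u * f v))"
    unfolding inner_vec_def
  proof (intro sum.cong refl, goal_cases)
    case (1 u)
    have "sqrt (d u) * f u * (sqrt (d u) * f u - S / sqrt (d u)) = d u * (f u)\<^sup>2 - f u * S" for S
      by (simp add: right_diff_distrib power2_eq_square mult_ac)
    with 1 show ?case by (simp add: scaled_def sum_distrib_left mult_ac)
  qed
  then show ?thesis by (simp add: energy_eq mass_def sum_subtractf)
qed

text \<open>Disjoint supports make the \<open>scaled (F i)\<close> orthogonal, so they span a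
  k-dimensional space. On it mass is additive and energy is additive up to the factor 2, which
  bounds the Rayleigh quotient by \<open>2 * c\<close>.\<close>

lemma eigval_normalized_laplacian_le:
  fixes F :: "'i \<Rightarrow> 'v \<Rightarrow> real"
  assumes I: "finite I" "card I = k" "1 \<le> k"
    and disj: "\<And>i j u. F i u \<noteq> 0 \<Longrightarrow> F j u \<noteq> 0 \<Longrightarrow> i = j"
    and F: "\<And>i. i \<in> I \<Longrightarrow> 0 < mass (F i) \<and> energy (F i) \<le> c * mass (F i)"
  shows "eigval k normalized_laplacian \<le> 2 * c"
proof (rule eigval_symmetric_le[OF transpose_normalized_laplacian I(3)])
  let ?Y = "\<lambda>i. scaled (F i)"
  have orth: "?Y i \<bullet> ?Y j = 0" if "i \<noteq> j" for i j
    unfolding inner_scaled using disj that by (intro sum.neutral) auto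
  have pos: "0 < ?Y i \<bullet> ?Y i" if "i \<in> I" for i using F that by (simp add: inner_scaled_self)
  have "inj_on ?Y I"
  proof (rule inj_onI, rule ccontr)
    fix i j assume "i \<in> I" "j \<in> I" "?Y i = ?Y j" "i \<noteq> j"
    then show False using orth[of i j] pos[of i] by simp
  qed
  then have "card (?Y ` I) = k" using I(2) by (simp add: card_image)
  moreover have "independent (?Y ` I)"
    using pos orth by (intro pairwise_orthogonal_independent) (force simp: pairwise_def orthogonal_def)+
  ultimately show "k \<le> dim (span (?Y ` I))" by (simp add: dim_eq_card_independent)
  show "subspace (span (?Y ` I))" by simp
  fix x assume "x \<in> span (?Y ` I)"
  then obtain a where x: "x = (\<Sum>y\<in>?Y ` I. a y *\<^sub>R y)"
    using span_finite[of "?Y ` I"] I(1) by auto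
  define b where "b i = a (?Y i)" for i
  have "x = (\<Sum>i\<in>I. b i *\<^sub>R ?Y i)"
    unfolding x b_def by (rule sum.reindex[OF \<open>inj_on ?Y I\<close>, unfolded comp_def])
  also have "\<dots> = scaled (\<lambda>u. \<Sum>i\<in>I. b i * F i u)"
    by (simp add: vec_eq_iff scaled_def sum_distrib_left mult_ac)
  finally have x: "x = scaled (\<lambda>u. \<Sum>i\<in>I. b i * F i u)" .
  have "energy (\<lambda>u. \<Sum>i\<in>I. b i * F i u) \<le> 2 * (\<Sum>i\<in>I. (b i)\<^sup>2 * energy (F i))"
    by (rule energy_disjoint_combination_le[OF I(1) disj])
  also have "\<dots> \<le> 2 * (\<Sum>i\<in>I. (b i)\<^sup>2 * (c * mass (F i)))"
    using F by (intro mult_left_mono sum_mono) auto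
  also have "\<dots> = 2 * c * mass (\<lambda>u. \<Sum>i\<in>I. b i * F i u)"
    by (subst mass_disjoint_combination[OF I(1) disj]) (simp_all add: sum_distrib_left mult_ac)
  finally show "x \<bullet> (normalized_laplacian *v x) \<le> 2 * c * (x \<bullet> x)"
    by (simp add: x inner_scaled_self inner_normalized_laplacian)
qed

lemma eigval_normalized_laplacian_attained:
  assumes "k \<in> {1..CARD('v)}"
  obtains f where "mass f = 1" "energy f = eigval k normalized_laplacian"
proof -
  obtain x where x: "norm x = 1" "normalized_laplacian *v x = eigval k normalized_laplacian *\<^sub>R x"
    using eigval_symmetric_eigenvector[OF transpose_normalized_laplacian assms] by blast
  obtain f where f: "x = scaled f" using scaled_surj by blast
  have "mass f = 1" using x(1) by (simp add: f dot_square_norm flip: inner_scaled_self)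
  moreover have "energy f = eigval k normalized_laplacian"
    using x(2) \<open>mass f = 1\<close> inner_normalized_laplacian[of f] by (simp add: f inner_scaled_self)
  ultimately show ?thesis using that by blast
qed

end

section \<open>Signed graphs\<close>

text \<open>The value 1 off the edge set makes the sign total, as \<open>signed_weights\<close>
  demands; the weight vanishes there.\<close>

definition edge_sign :: "'v signed_graph \<Rightarrow> 'v \<Rightarrow> 'v \<Rightarrow> real" where
  "edge_sign \<Gamma> u v = (if {u, v} \<in> edges \<Gamma> then of_int (sgn_of \<Gamma> {u, v}) else 1)"

lemma signed_weights_of_graph:
  assumes "is_signed_graph \<Gamma>"
  shows "signed_weights (weight \<Gamma>) (edge_sign \<Gamma>) (vdegree \<Gamma>)"
proof
  fix u v
  show "0 \<le> weight \<Gamma> u v" using assms unfolding is_signed_graph_def by (metis less_eq_real_def)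
  show "weight \<Gamma> u v = weight \<Gamma> v u" using assms unfolding is_signed_graph_def by blast
  show "edge_sign \<Gamma> u v = edge_sign \<Gamma> v u" by (simp add: edge_sign_def insert_commute)
  show "edge_sign \<Gamma> u v = 1 \<or> edge_sign \<Gamma> u v = -1"
    using assms unfolding is_signed_graph_def edge_sign_def by (metis of_int_1 of_int_minus)
  show "0 < vdegree \<Gamma> u" using assms unfolding is_signed_graph_def by blast
qed (simp add: vdegree_def)

section \<open>Cheeger quotients as total variations\<close>

lemma signed_cut_eq_indicator_sum:
  fixes \<Gamma> :: "'v::finite signed_graph"
  assumes "is_signed_graph \<Gamma>" "c = 1 \<or> c = -1"
  shows "signed_cut c \<Gamma> A B = (\<Sum>u\<in>UNIV. \<Sum>v\<in>UNIV. weight \<Gamma> u v *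
    (indicat_real A u * indicat_real B v * (if edge_sign \<Gamma> u v = of_int c then 1 else 0)))"
proof -
  have w0: "{u, v} \<notin> edges \<Gamma> \<Longrightarrow> weight \<Gamma> u v = 0" for u v
    using assms(1) unfolding is_signed_graph_def by blast
  have "signed_cut c \<Gamma> A B = (\<Sum>u\<in>A. \<Sum>v\<in>UNIV. weight \<Gamma> u v *
      (indicat_real B v * (if edge_sign \<Gamma> u v = of_int c then 1 else 0)))"
    unfolding signed_cut_def
  proof (rule sum.cong[OF refl])
    fix u
    show "(\<Sum>v | v \<in> B \<and> {u, v} \<in> edges \<Gamma> \<and> sgn_of \<Gamma> {u, v} = c. weight \<Gamma> u v)
      = (\<Sum>v\<in>UNIV. weight \<Gamma> u v * (indicat_real B v * (if edge_sign \<Gamma> u v = of_int c then 1 else 0)))"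
      by (rule sum.mono_neutral_cong_left) (use w0 in \<open>auto simp: edge_sign_def indicator_def\<close>)
  qed
  also have "\<dots> = (\<Sum>u\<in>UNIV. \<Sum>v\<in>UNIV. weight \<Gamma> u v *
    (indicat_real A u * indicat_real B v * (if edge_sign \<Gamma> u v = of_int c then 1 else 0)))"
    by (rule sum.mono_neutral_cong_left) (auto simp: indicator_def)
  finally show ?thesis .
qed

lemma cut_eq_indicator_sum:
  fixes \<Gamma> :: "'v::finite signed_graph"
  shows "cut \<Gamma> A B = (\<Sum>u\<in>UNIV. \<Sum>v\<in>UNIV. weight \<Gamma> u v * (indicat_real A u * indicat_real B v))"
proof -
  have "cut \<Gamma> A B = (\<Sum>u\<in>A. \<Sum>v\<in>UNIV. weight \<Gamma> u v * indicat_real B v)"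
    unfolding cut_def by (intro sum.cong refl sum.mono_neutral_cong_left) (auto simp: indicator_def)
  also have "\<dots> = (\<Sum>u\<in>UNIV. \<Sum>v\<in>UNIV. weight \<Gamma> u v * (indicat_real A u * indicat_real B v))"
    by (rule sum.mono_neutral_cong_left) (auto simp: indicator_def)
  finally show ?thesis .
qed

text \<open>The numerator of \<open>signed_beta\<close> lists mixed pairs in one order only, while
  the variation lists both; symmetrizing allows a comparison pair by pair.\<close>

lemma (in signed_weights) sum_symmetrize:
  "(\<Sum>u\<in>UNIV. \<Sum>v\<in>UNIV. w u v * p u v) = (\<Sum>u\<in>UNIV. \<Sum>v\<in>UNIV. w u v * (p u v + p v u)) / 2"
proof -
  have "(\<Sum>u\<in>UNIV. \<Sum>v\<in>UNIV. w u v * p v u) = (\<Sum>u\<in>UNIV. \<Sum>v\<in>UNIV. w u v * p u v)"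
    by (subst sum.swap) (simp add: w_sym)
  then show ?thesis by (simp add: distrib_left sum.distrib)
qed

text \<open>For the function 1 on \<open>V1\<close>, -1 on \<open>V2\<close> and 0 elsewhere, an
  edge varies by 2 if its sign contradicts the partition, by 1 if it leaves
  \<open>V1 \<union> V2\<close>, and by 0 otherwise.\<close>

lemma signed_beta_eq_variation:
  fixes \<Gamma> :: "'v::finite signed_graph"
  assumes "is_signed_graph \<Gamma>" "V1 \<inter> V2 = {}"
  shows "signed_beta \<Gamma> \<mu> V1 V2 = signed_weights.variation (weight \<Gamma>) (edge_sign \<Gamma>)
    (\<lambda>u. indicat_real V1 u - indicat_real V2 u) / vol \<mu> (V1 \<union> V2)"
proof -
  interpret signed_weights "weight \<Gamma>" "edge_sign \<Gamma>" "vdegree \<Gamma>"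
    using assms(1) by (rule signed_weights_of_graph)
  let ?i = "\<lambda>A u. indicat_real A u" and ?e = "\<lambda>c u v. if edge_sign \<Gamma> u v = of_int c then 1 else 0 :: real"
  define p where "p u v = 2 * (?i V1 u * ?i V2 v * ?e 1 u v) + ?i V1 u * ?i V1 v * ?e (-1) u v
    + ?i V2 u * ?i V2 v * ?e (-1) u v + ?i (V1 \<union> V2) u * ?i (- (V1 \<union> V2)) v" for u v
  have "2 * signed_cut 1 \<Gamma> V1 V2 + signed_cut (-1) \<Gamma> V1 V1 + signed_cut (-1) \<Gamma> V2 V2
      + cut \<Gamma> (V1 \<union> V2) (- (V1 \<union> V2)) = (\<Sum>u\<in>UNIV. \<Sum>v\<in>UNIV. weight \<Gamma> u v * p u v)"
    by (simp only: signed_cut_eq_indicator_sum[OF assms(1)] cut_eq_indicator_sum p_def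
        distrib_left sum.distrib sum_distrib_left mult.left_commute[of 2] simp_thms)
  also have "\<dots> = (\<Sum>u\<in>UNIV. \<Sum>v\<in>UNIV. weight \<Gamma> u v * (p u v + p v u)) / 2"
    by (rule sum_symmetrize)
  also have "\<dots> = variation (\<lambda>u. ?i V1 u - ?i V2 u)"
  proof -
    have "p u v + p v u = \<bar>(?i V1 u - ?i V2 u) - edge_sign \<Gamma> u v * (?i V1 v - ?i V2 v)\<bar>" for u v
      using s_sign[of u v] s_sym[of u v] assms(2) unfolding p_def
      by (cases "u \<in> V1"; cases "u \<in> V2"; cases "v \<in> V1"; cases "v \<in> V2") auto
    then show ?thesis by (simp add: variation_def)
  qed
  finally show ?thesis by (simp add: signed_beta_def)
qed

text \<open>The diagonal matrices D^(-1/2) and D^(1/2) conjugate the symmetric matrix to the signed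
  Laplacian.\<close>

lemma charpoly_signed_laplacian:
  fixes \<Gamma> :: "'v::finite signed_graph"
  assumes "is_signed_graph \<Gamma>"
  shows "charpoly (signed_laplacian \<Gamma>)
    = charpoly (signed_weights.normalized_laplacian (weight \<Gamma>) (edge_sign \<Gamma>) (vdegree \<Gamma>))"
proof -
  interpret signed_weights "weight \<Gamma>" "edge_sign \<Gamma>" "vdegree \<Gamma>"
    using assms by (rule signed_weights_of_graph)
  let ?d = "vdegree \<Gamma>"
  have diag: "(\<chi> u v. if u = v then a u else 0) ** A = (\<chi> u v. a u * A $ u $ v)"
    "A ** (\<chi> u v. if u = v then a u else 0) = (\<chi> u v. A $ u $ v * a v)" for a :: "'v \<Rightarrow> real" and A
    by (simp_all add: matrix_matrix_mult_def vec_eq_iff if_distrib if_distribR sum.delta sum.delta' cong: if_cong)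
  define X :: "real ^ 'v ^ 'v" where "X = (\<chi> u v. if u = v then 1 / sqrt (?d u) else 0)"
  define Y :: "real ^ 'v ^ 'v" where "Y = (\<chi> u v. if u = v then sqrt (?d u) else 0)"
  define Z :: "real ^ 'v ^ 'v" where "Z = (\<chi> u v. if u = v then 1 / ?d u else 0)"
  have XY: "X ** Y = mat 1"
    unfolding X_def Y_def by (subst diag) (simp add: mat_def vec_eq_iff)
  have "degree_matrix \<Gamma> ** Z = mat 1" "Z ** degree_matrix \<Gamma> = mat 1"
    unfolding Z_def degree_matrix_def by (simp_all add: diag mat_def vec_eq_iff)
  \<comment> \<open>\<open>matrix_inv\<close> is given by a choice operator, so uniqueness of
    two-sided inverses is needed to identify it.\<close>
  then have inv: "matrix_inv (degree_matrix \<Gamma>) = Z"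
    unfolding matrix_inv_def
    by (intro some_equality) (auto, metis matrix_mul_assoc matrix_mul_lid matrix_mul_rid)
  have w0: "{u, v} \<notin> edges \<Gamma> \<Longrightarrow> weight \<Gamma> u v = 0" for u v
    using assms unfolding is_signed_graph_def by blast
  have adj: "signed_adjacency \<Gamma> $ u $ v = weight \<Gamma> u v * edge_sign \<Gamma> u v" for u v
    using w0[of u v] by (simp add: signed_adjacency_def edge_sign_def)
  have "signed_laplacian \<Gamma> $ u $ v = (X ** normalized_laplacian ** Y) $ u $ v" for u v
  proof -
    have "signed_laplacian \<Gamma> $ u $ v = (if u = v then 1 else 0) - weight \<Gamma> u v * edge_sign \<Gamma> u v / ?d u"
      by (simp add: signed_laplacian_def inv Z_def diag adj mat_def)
    moreover have "(X ** normalized_laplacian ** Y) $ u $ v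
        = 1 / sqrt (?d u) * normalized_laplacian $ u $ v * sqrt (?d v)"
      by (simp add: X_def Y_def diag)
    moreover have "sqrt (?d u) * sqrt (?d u) = ?d u" by simp
    then have "1 / sqrt (?d u) * (weight \<Gamma> u v * edge_sign \<Gamma> u v / (sqrt (?d u) * sqrt (?d v))) * sqrt (?d v)
        = weight \<Gamma> u v * edge_sign \<Gamma> u v / ?d u" by simp
    ultimately show ?thesis
      by (simp add: normalized_laplacian_def left_diff_distrib right_diff_distrib)
  qed
  then have "signed_laplacian \<Gamma> = X ** normalized_laplacian ** Y" by (simp add: vec_eq_iff)
  then show ?thesis using charpoly_similar[OF XY] by simp
qed

section \<open>The Cheeger constant and the final bound\<close>

lemma cheeger1_attained_and_le:
  fixes \<Gamma> :: "'v::finite signed_graph"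
  obtains V1 V2 where "V1 \<inter> V2 = {}" "V1 \<union> V2 \<noteq> {}" "cheeger1 \<Gamma> \<mu> = signed_beta \<Gamma> \<mu> V1 V2"
    and "\<And>W1 W2. W1 \<inter> W2 = {} \<Longrightarrow> W1 \<union> W2 \<noteq> {} \<Longrightarrow> cheeger1 \<Gamma> \<mu> \<le> signed_beta \<Gamma> \<mu> W1 W2"
proof -
  let ?S = "{signed_beta \<Gamma> \<mu> V1 V2 | V1 V2. V1 \<inter> V2 = {} \<and> V1 \<union> V2 \<noteq> {}}"
  have "?S \<subseteq> (\<lambda>(V1, V2). signed_beta \<Gamma> \<mu> V1 V2) ` UNIV" by auto
  then have fin: "finite ?S" by (rule finite_subset) simp
  have "signed_beta \<Gamma> \<mu> UNIV {} \<in> ?S" by blast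
  then have "cheeger1 \<Gamma> \<mu> \<in> ?S" unfolding cheeger1_def using fin by (intro Min_in) blast+
  moreover have "cheeger1 \<Gamma> \<mu> \<le> signed_beta \<Gamma> \<mu> W1 W2" if "W1 \<inter> W2 = {}" "W1 \<union> W2 \<noteq> {}" for W1 W2
    unfolding cheeger1_def using fin that by (intro Min_le) blast+
  ultimately show ?thesis using that by blast
qed

theorem theorem1p4:
  fixes \<Gamma> :: "'v::finite signed_graph" and k :: nat
  assumes "is_signed_graph \<Gamma>"
    and "k \<in> {1..CARD('v)}"
  shows "cheeger1 \<Gamma> (vdegree \<Gamma>)
           \<le> 16 * sqrt 2 * real k
               * (eigval 1 (signed_laplacian \<Gamma>) / sqrt (eigval k (signed_laplacian \<Gamma>)))
       \<and> (eigval 1 (signed_laplacian \<Gamma>) \<noteq> 0 \<longrightarrow>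
            cheeger1 \<Gamma> (vdegree \<Gamma>)
              < 16 * sqrt 2 * real k
                  * (eigval 1 (signed_laplacian \<Gamma>) / sqrt (eigval k (signed_laplacian \<Gamma>))))"
proof -
  interpret signed_weights "weight \<Gamma>" "edge_sign \<Gamma>" "vdegree \<Gamma>"
    using assms(1) by (rule signed_weights_of_graph)
  let ?d = "vdegree \<Gamma>"
  define h where "h = cheeger1 \<Gamma> ?d"
  define ev where "ev j = eigval j normalized_laplacian" for j
  have ev: "eigval j (signed_laplacian \<Gamma>) = ev j" for j
    by (simp add: ev_def eigval_def charpoly_signed_laplacian[OF assms(1)])
  obtain V1 V2 where V: "V1 \<inter> V2 = {}" "h = signed_beta \<Gamma> ?d V1 V2"
    and h_le: "\<And>W1 W2. W1 \<inter> W2 = {} \<Longrightarrow> W1 \<union> W2 \<noteq> {} \<Longrightarrow> h \<le> signed_beta \<Gamma> ?d W1 W2"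
    using cheeger1_attained_and_le[of \<Gamma> ?d] unfolding h_def by metis
  have "0 \<le> h"
    unfolding V(2) signed_beta_eq_variation[OF assms(1) V(1)] vol_def
    by (intro divide_nonneg_nonneg variation_nonneg sum_nonneg) (simp add: d_pos less_imp_le)
  \<comment> \<open>Functions with values in {-1, 0, 1} correspond to disjoint pairs; the zero
    function gives the excluded empty pair and is treated separately.\<close>
  have cut: "h * (\<Sum>u\<in>UNIV. ?d u * \<bar>g u\<bar>) \<le> variation g" for g
  proof (rule variation_ge_of_sign_functions)
    fix p :: "'v \<Rightarrow> real" assume p: "\<And>u. p u \<in> {-1, 0, 1}"
    define W1 W2 where "W1 = {u. p u = 1}" and "W2 = {u. p u = -1}"
    have W: "W1 \<inter> W2 = {}" by (auto simp: W1_def W2_def)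
    have pW: "p u = indicat_real W1 u - indicat_real W2 u" for u
      using p[of u] by (auto simp: W1_def W2_def)
    have "\<bar>p u\<bar> = indicat_real (W1 \<union> W2) u" for u
      using p[of u] by (auto simp: W1_def W2_def)
    then have vol: "(\<Sum>u\<in>UNIV. ?d u * \<bar>p u\<bar>) = vol ?d (W1 \<union> W2)"
      by (simp add: vol_def Un_def)
    show "h * (\<Sum>u\<in>UNIV. ?d u * \<bar>p u\<bar>) \<le> variation p"
    proof (cases "W1 \<union> W2 = {}")
      case True
      then show ?thesis unfolding vol by (simp add: vol_def variation_nonneg)
    next
      case False
      then have "0 < vol ?d (W1 \<union> W2)" unfolding vol_def by (intro sum_pos) (auto simp: d_pos)
      moreover have "h \<le> variation p / vol ?d (W1 \<union> W2)"
        using h_le[OF W False] unfolding signed_beta_eq_variation[OF assms(1) W] pW[symmetric] .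
      ultimately show ?thesis unfolding vol by (simp add: pos_le_divide_eq)
    qed
  qed
  obtain f where f: "mass f = 1" "energy f = ev 1"
    using eigval_normalized_laplacian_attained[of 1] assms(2) unfolding ev_def by auto
  obtain fk where fk: "mass fk = 1" "energy fk = ev k"
    using eigval_normalized_laplacian_attained[of k] assms(2) unfolding ev_def by blast
  have mono: "ev 1 \<le> ev k"
    unfolding ev_def using assms(2) by (intro eigval_symmetric_mono transpose_normalized_laplacian) auto
  have "ev k \<le> 2" using energy_le_two_mass[of fk] fk by simp
  show ?thesis
  \<comment> \<open>If the energy of \<open>f\<close> is 0, so is its variation, and the coarea
    inequality forces \<open>h\<close> to be 0. Both sides are then 0 (also when
    \<open>ev k = 0\<close>, as division by 0 gives 0), so only the weak inequality holds.\<close>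
  proof (cases "ev 1 = 0")
    case True
    have w0: "weight \<Gamma> u v * (f u - edge_sign \<Gamma> u v * f v)\<^sup>2 = 0" for u v
    proof -
      have "(\<Sum>u\<in>UNIV. \<Sum>v\<in>UNIV. weight \<Gamma> u v * (f u - edge_sign \<Gamma> u v * f v)\<^sup>2) = 0"
        using f(2) True by (simp add: energy_def)
      then show ?thesis by (simp add: sum_nonneg_eq_0_iff sum_nonneg w_nonneg)
    qed
    then have "variation f = 0"
      unfolding variation_def by (auto intro!: sum.neutral)
    moreover obtain u where "f u \<noteq> 0" using f(1) by (force simp: mass_def)
    then have "0 < (\<Sum>u\<in>UNIV. ?d u * \<bar>f u\<bar>)"
      by (intro sum_pos2[of _ u]) (auto simp: d_pos less_imp_le)
    ultimately have "h \<le> 0" using cut[of f] by (simp add: mult_le_0_iff)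
    then show ?thesis unfolding ev h_def[symmetric] using True by simp
  next
    case False
    then have pos: "0 < ev 1" using energy_nonneg[of f] f(2) by simp
    have "h < 16 * sqrt 2 * k * (energy f / sqrt (ev k))"
    proof (rule improved_cheeger_bound[OF cut \<open>0 \<le> h\<close> f(1)])
      fix F :: "nat \<Rightarrow> 'v \<Rightarrow> real" and I c
      assume "finite I" "card I = k" "\<And>i j u. F i u \<noteq> 0 \<Longrightarrow> F j u \<noteq> 0 \<Longrightarrow> i = j"
        "\<And>i. i \<in> I \<Longrightarrow> 0 < mass (F i) \<and> energy (F i) \<le> c * mass (F i)"
      then show "ev k \<le> 2 * c"
        unfolding ev_def using assms(2) by (intro eigval_normalized_laplacian_le[of I k F c]) auto
    qed (use assms(2) pos mono \<open>ev k \<le> 2\<close> f(2) in auto)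
    then show ?thesis unfolding ev h_def[symmetric] f(2) by simp
  qed
qed

end
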